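(* Let $g:V^0\to\mathbb{R}$. For each $n\in\mathbb{N}$ let $u^n$ be the (unique) function in $\mathrm{AMLE}(V^n)$ with $u^n=g$ on $V^0$, and let $u$ be the (unique) function in $\mathrm{AMLE}(\mathcal{S})$ with $u=g$ on $V^0$. Then $u^n\to u$ uniformly, i.e. $$\lim_{n\to\infty}\ \sup_{x\in V^n}|u^n(x)-u(x)|=0 .$$
   Context: Let $q_1,q_2,q_3\in\mathbb{R}^2$ be the vertices of an equilateral triangle of side $1$, $V^0=\{q_1,q_2,q_3\}$, and $\psi_i(x)=q_i+\frac12(x-q_i)$ for $i=1,2,3$. For $n\in\mathbb{N}$, $V^n=\bigcup \psi_{w_1}\circ\dots\circ\psi_{w_n}(V^0)$, the union over all words $w=(w_1,\dots,w_n)\in\{1,2,3\}^n$. The Sierpinski gasket $\mathcal{S}$ is the closure in $\mathbb{R}^2$ of $\bigcup_{n\ge0}V^n$. For $x,y\in V^n$ write $x\sim_n y$ iff the segment joining $x$ and $y$ is the image of a side of the initial triangle under some $\psi_{w_1}\circ\dots\circ\psi_{w_n}$. Set $\delta_n=2^{-n}$. Discrete notions. For a nonempty $K\subset V^n\setminus V^0$: $\partial K=\{y\in V^n\setminus K:\ \exists x\in K,\ y\sim_n x\}$ and $\overline K=K\cup\partial K$. For $x,y\in\overline K$, $d_{n,K}(x,y)$ is the minimum of $N\delta_n$ over all finite paths $\{x=x_0,x_1,\dots,x_N=y\}$ with $x_i\sim_n x_{i+1}$ for $i=0,\dots,N-1$ that stay inside $K$, meaning $x_i\in K$ for $i=1,\dots,N-1$,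 and where a single edge joining two points of $\partial K$ is not an admissible path (so $N\ge 2$ if $x\ne y$ both lie in $\partial K$); $d_{n,K}(x,x)=0$, and $d_{n,K}(x,y)=+\infty$ if there is no such path. $K$ is connected if $d_{n,K}(x,y)<+\infty$ for all $x,y\in\overline K$. For $u:V^n\to\mathbb{R}$, $\mathrm{Lip}^n(u,K)=\max_{x,y\in\overline K,\,x\ne y}\frac{|u(x)-u(y)|}{d_{n,K}(x,y)}$. $\mathrm{AMLE}(V^n)$ is the set of $u:V^n\to\mathbb{R}$ such that for every (nonempty) connected $K\subset V^n\setminus V^0$ and every $v:V^n\to\mathbb{R}$ with $u=v$ on $\partial K$ one has $\mathrm{Lip}^n(u,K)\le\mathrm{Lip}^n(v,K)$. For every $g:V^0\to\mathbb{R}$ there is a unique element of $\mathrm{AMLE}(V^n)$ equal to $g$ on $V^0$. Notions on $\mathcal{S}$. $\mathcal{S}$ is endowed with the path distance $d(x,y)=\inf\{\ell(\gamma):\gamma \text{ a path in }\mathcal{S}\text{ joining }x\text{ to }y\}$, $\ell(\gamma)$ being the length of $\gamma$. For $A\subset\mathcal{S}$ and a function $f$, $\mathrm{Lip}(f,A)=\sup_{x,y\in\overline A,\,x\ne y}\frac{|f(y)-f(x)|}{d(x,y)}$ ($\overline A$ and $\partial A$ are the topological closure and boundary in $\mathcal{S}$). $\mathrm{AMLE}(\mathcal{S})$ is the set of continuous $u:\mathcal{S}\to\mathbb{R}$ such that for every proper, open, connected set $A\subset\mathcal{S}\setminus V^0$ and every $v:\mathcal{S}\to\mathbb{R}$ with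 $u=v$ on $\partial A$ one has $\mathrm{Lip}(u,A)\le\mathrm{Lip}(v,A)$. It is known that for every $g:V^0\to\mathbb{R}$ there is a unique element of $\mathrm{AMLE}(\mathcal{S})$ equal to $g$ on $V^0$. *)

theory Defs
  imports "HOL-Analysis.Analysis"
begin

definition unit_triangle :: "(3 \<Rightarrow> real^2) \<Rightarrow> bool" where
  "unit_triangle q \<longleftrightarrow> (\<forall>i j. i \<noteq> j \<longrightarrow> dist (q i) (q j) = 1)"

definition psi :: "(3 \<Rightarrow> real^2) \<Rightarrow> 3 \<Rightarrow> real^2 \<Rightarrow> real^2" where
  "psi q i x = q i + (1/2) *\<^sub>R (x - q i)"

primrec psi_word :: "(3 \<Rightarrow> real^2) \<Rightarrow> 3 list \<Rightarrow> real^2 \<Rightarrow> real^2" where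
  "psi_word q [] = id"
| "psi_word q (i # w) = psi q i \<circ> psi_word q w"

definition V :: "(3 \<Rightarrow> real^2) \<Rightarrow> nat \<Rightarrow> (real^2) set" where
  "V q n = (\<Union>w\<in>{w. length w = n}. psi_word q w ` range q)"

definition gasket :: "(3 \<Rightarrow> real^2) \<Rightarrow> (real^2) set" where
  "gasket q = closure (\<Union>n. V q n)"

definition adj :: "(3 \<Rightarrow> real^2) \<Rightarrow> nat \<Rightarrow> real^2 \<Rightarrow> real^2 \<Rightarrow> bool" where
  "adj q n x y \<longleftrightarrow> (\<exists>w i j. length w = n \<and> i \<noteq> j \<and>
     closed_segment x y = psi_word q w ` closed_segment (q i) (q j))"

definition mesh :: "nat \<Rightarrow> real" where
  "mesh n = 1 / 2 ^ n"

definition dbdry :: "(3 \<Rightarrow> real^2) \<Rightarrow> nat \<Rightarrow> (real^2) set \<Rightarrow> (real^2) set" where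
  "dbdry q n K = {y \<in> V q n - K. \<exists>x\<in>K. adj q n y x}"

definition dclosure :: "(3 \<Rightarrow> real^2) \<Rightarrow> nat \<Rightarrow> (real^2) set \<Rightarrow> (real^2) set" where
  "dclosure q n K = K \<union> dbdry q n K"

definition dpath ::
  "(3 \<Rightarrow> real^2) \<Rightarrow> nat \<Rightarrow> (real^2) set \<Rightarrow> real^2 \<Rightarrow> real^2 \<Rightarrow> nat \<Rightarrow> (nat \<Rightarrow> real^2) \<Rightarrow> bool" where
  "dpath q n K x y N p \<longleftrightarrow>
     p 0 = x \<and> p N = y \<and>
     (\<forall>i<N. adj q n (p i) (p (Suc i))) \<and>
     (\<forall>i. 0 < i \<and> i < N \<longrightarrow> p i \<in> K) \<and>
     \<not> (N = 1 \<and> x \<in> dbdry q n K \<and> y \<in> dbdry q n K)"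

text \<open>The infimum over a nonempty set is attained, as the competitors are natural multiples of
  the mesh size; over the empty set it is \<open>\<infinity>\<close>.\<close>

definition ddist :: "(3 \<Rightarrow> real^2) \<Rightarrow> nat \<Rightarrow> (real^2) set \<Rightarrow> real^2 \<Rightarrow> real^2 \<Rightarrow> ereal" where
  "ddist q n K x y =
     (if x = y then 0 else Inf {ereal (real N * mesh n) | N p. dpath q n K x y N p})"

definition dconnected :: "(3 \<Rightarrow> real^2) \<Rightarrow> nat \<Rightarrow> (real^2) set \<Rightarrow> bool" where
  "dconnected q n K \<longleftrightarrow>
     (\<forall>x\<in>dclosure q n K. \<forall>y\<in>dclosure q n K. ddist q n K x y < \<infinity>)"

text \<open>The set of quotients is finite, and nonempty for nonempty \<open>K \<subseteq> V q n - V q 0\<close>,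
  so that the supremum is a maximum.\<close>

definition dLip :: "(3 \<Rightarrow> real^2) \<Rightarrow> nat \<Rightarrow> (real^2 \<Rightarrow> real) \<Rightarrow> (real^2) set \<Rightarrow> ereal" where
  "dLip q n u K =
     Sup {ereal \<bar>u x - u y\<bar> / ddist q n K x y | x y.
            x \<in> dclosure q n K \<and> y \<in> dclosure q n K \<and> x \<noteq> y}"

text \<open>Functions on \<open>V q n\<close>, and on the gasket below, are represented by total functions; their
  values elsewhere are irrelevant.\<close>

definition dAMLE :: "(3 \<Rightarrow> real^2) \<Rightarrow> nat \<Rightarrow> (real^2 \<Rightarrow> real) set" where
  "dAMLE q n = {u. \<forall>K v. K \<noteq> {} \<and> K \<subseteq> V q n - V q 0 \<and> dconnected q n K \<and>
     (\<forall>x\<in>dbdry q n K. u x = v x) \<longrightarrow> dLip q n u K \<le> dLip q n v K}"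

definition curve_length :: "(real \<Rightarrow> real^2) \<Rightarrow> ereal" where
  "curve_length \<gamma> =
     Sup {ereal (\<Sum>i<N. dist (\<gamma> (t i)) (\<gamma> (t (Suc i)))) | N t.
            t 0 = 0 \<and> t N = 1 \<and> (\<forall>i<N. t i \<le> t (Suc i))}"

definition gdist :: "(3 \<Rightarrow> real^2) \<Rightarrow> real^2 \<Rightarrow> real^2 \<Rightarrow> ereal" where
  "gdist q x y =
     Inf {curve_length \<gamma> | \<gamma>. path \<gamma> \<and> path_image \<gamma> \<subseteq> gasket q \<and>
            pathstart \<gamma> = x \<and> pathfinish \<gamma> = y}"

text \<open>The topology on the gasket is the subspace topology of the plane; the path distance induces
  the same topology, being equivalent to the Euclidean one.\<close>

abbreviation gtop :: "(3 \<Rightarrow> real^2) \<Rightarrow> (real^2) topology" where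
  "gtop q \<equiv> top_of_set (gasket q)"

definition gLip :: "(3 \<Rightarrow> real^2) \<Rightarrow> (real^2 \<Rightarrow> real) \<Rightarrow> (real^2) set \<Rightarrow> ereal" where
  "gLip q f A =
     Sup {ereal \<bar>f y - f x\<bar> / gdist q x y | x y.
            x \<in> gtop q closure_of A \<and> y \<in> gtop q closure_of A \<and> x \<noteq> y}"

definition gAMLE :: "(3 \<Rightarrow> real^2) \<Rightarrow> (real^2 \<Rightarrow> real) set" where
  "gAMLE q = {u. continuous_on (gasket q) u \<and>
     (\<forall>A v. A \<noteq> gasket q \<and> openin (gtop q) A \<and> connected A \<and> A \<subseteq> gasket q - V q 0 \<and>
        (\<forall>x\<in>gtop q frontier_of A. u x = v x) \<longrightarrow> gLip q u A \<le> gLip q v A)}"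

end

theory Submission
  imports Defs
begin

text \<open>
  Both problems are compared directly at a fixed level \<open>n\<close>, without passing to limits of
  subsequences and without a uniqueness theorem on the gasket.

  On the side of the graphs, testing the minimality of \<open>u\<^sup>n\<close> with one-point sets shows that
  \<open>u\<^sup>n\<close> is infinity harmonic: at each interior vertex its value is the mean of the largest and the
  smallest neighbouring value (\<open>dAMLE_harmonic\<close>). Such functions obey a comparison principle on finite
  graphs (\<open>graph_comparison\<close>).

  On the side of the gasket, the idea is the finite difference argument that Armstrong and Smart used
  for Jensen's uniqueness theorem. An absolutely minimizing \<open>u\<close> satisfies comparison with cones; applied to a
  cone centred at a vertex \<open>x\<close> and reaching two edges far, this says that \<open>u\<close> at a neighbour of \<open>x\<close>
  is at most the mean of \<open>u x\<close> and of an upper bound \<open>M\<close> for \<open>u\<close> on the vertices at most two edges away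
  (\<open>AMLE_two_step\<close>). The maximum \<open>a x\<close> of \<open>u\<close> over \<open>x\<close> and its neighbours in the graph is therefore
  an exact subsolution of the discrete equation, away from the corners. It differs from \<open>u\<close>
  by at most the oscillation of \<open>u\<close> at scale \<^term>\<open>mesh n\<close>. Near a corner, an affine barrier
  (\<open>inf_harmonic_barrier\<close>) bounds \<open>u\<^sup>n\<close> from below by the corner value minus a multiple of
  \<^term>\<open>mesh n\<close>. The comparison principle then gives \<open>u \<le> a \<le> u\<^sup>n\<close> up to an error that tends to 0 by
  uniform continuity of \<open>u\<close> (\<open>AMLE_le_harmonic\<close>). Passing to \<open>-u\<close> and \<open>-u\<^sup>n\<close> gives the opposite bound.

  The geometry enters through three facts: distinct cells of equal level meet only in vertices, distinct vertices of
  level \<open>n\<close> are at distance at least \<^term>\<open>mesh n\<close>, and the gasket is locally connected. The distance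
  from \<open>x\<close> that the cones need is replaced by an explicit function glued from Euclidean distances
  (\<open>star_cone\<close>), so that no geodesics other than straight edges occur.
\<close>

section \<open>The similarities and the approximating graphs\<close>

lemma psi_midpoint: "psi q j x = (1/2) *\<^sub>R x + (1/2) *\<^sub>R q j"
  by (simp add: psi_def scaleR_diff_right)

lemma psi_word_affine: "psi_word q w x = psi_word q w 0 + (1 / 2 ^ length w) *\<^sub>R x"
  by (induction w) (simp_all add: psi_midpoint scaleR_add_right divide_simps)

lemma dist_psi_word: "dist (psi_word q w x) (psi_word q w y) = mesh (length w) * dist x y"
  by (subst (1 2) psi_word_affine) (simp add: dist_norm mesh_def flip: scaleR_diff_right)

lemma inj_psi: "psi q j x = psi q j y \<longleftrightarrow> x = y"
  by (simp add: psi_midpoint)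

lemma psi_word_segment:
  "psi_word q w ` closed_segment x y = closed_segment (psi_word q w x) (psi_word q w y)"
proof -
  have *: "psi_word q w z = psi_word q w 0 + (1 / 2 ^ length w) *\<^sub>R z" for z
    by (rule psi_word_affine)
  have "psi_word q w ` closed_segment x y =
      (+) (psi_word q w 0) ` (*\<^sub>R) (1 / 2 ^ length w) ` closed_segment x y"
    unfolding image_image by (rule image_cong [OF refl *])
  also have "\<dots> = closed_segment (psi_word q w 0 + (1 / 2 ^ length w) *\<^sub>R x)
                                (psi_word q w 0 + (1 / 2 ^ length w) *\<^sub>R y)"
    by (subst closed_segment_linear_image [symmetric, OF linear_scaleR])
       (rule closed_segment_translation [symmetric])
  also have "\<dots> = closed_segment (psi_word q w x) (psi_word q w y)"
    by (simp only: * [symmetric])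
  finally show ?thesis .
qed

lemma continuous_on_psi_word: "continuous_on S (psi_word q w)"
proof -
  have "continuous_on S (\<lambda>x. psi_word q w 0 + (1 / 2 ^ length w) *\<^sub>R x)"
    by (intro continuous_intros)
  then show ?thesis
    by (rule continuous_on_eq) (rule psi_word_affine [symmetric])
qed

lemma continuous_on_psi: "continuous_on S (psi q i)"
  unfolding psi_def by (intro continuous_intros)

lemma mesh_pos [simp]: "0 < mesh n" and mesh_Suc: "mesh (Suc n) = mesh n / 2"
  by (simp_all add: mesh_def)

lemma V_0: "V q 0 = range q"
  by (simp add: V_def)

lemma V_iff: "x \<in> V q n \<longleftrightarrow> (\<exists>w i. length w = n \<and> x = psi_word q w (q i))"
  by (auto simp: V_def)

lemma V_Suc_iff: "x \<in> V q (Suc n) \<longleftrightarrow> (\<exists>i. \<exists>y\<in>V q n. x = psi q i y)"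
  unfolding V_iff Bex_def
  by (auto simp: length_Suc_conv) (metis length_Cons psi_word.simps(2) comp_apply)+

lemma psi_vertex [simp]: "psi q i (q i) = q i"
  by (simp add: psi_def)

lemma psi_commute: "psi q i (q j) = psi q j (q i)"
  by (simp add: psi_midpoint add.commute)

lemma vertex_in_V: "q i \<in> V q n"
  by (induction n) (auto simp: V_0 V_Suc_iff intro: psi_vertex [symmetric])

lemma V_mono_Suc: "x \<in> V q n \<Longrightarrow> x \<in> V q (Suc n)"
proof (induction n arbitrary: x)
  case 0
  then show ?case by (auto simp: V_0 intro: vertex_in_V)
next
  case (Suc n)
  then show ?case by (metis V_Suc_iff)
qed

lemma finite_V: "finite (V q n)"
proof -
  have "finite {w :: 3 list. length w = n}"
    using finite_lists_length_eq [of "UNIV :: 3 set" n] by simp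
  then show ?thesis unfolding V_def by auto
qed

lemma adj_iff: "adj q n x y \<longleftrightarrow>
    (\<exists>w i j. length w = n \<and> i \<noteq> j \<and> x = psi_word q w (q i) \<and> y = psi_word q w (q j))"
  unfolding adj_def psi_word_segment closed_segment_eq doubleton_eq_iff by metis

lemma adj_sym: "adj q n x y \<Longrightarrow> adj q n y x"
  unfolding adj_iff by metis

lemma adj_in_V: "adj q n x y \<Longrightarrow> x \<in> V q n" "adj q n x y \<Longrightarrow> y \<in> V q n"
  unfolding adj_iff V_iff by metis+

lemma adj_psi: "adj q n x y \<Longrightarrow> adj q (Suc n) (psi q i x) (psi q i y)"
  unfolding adj_iff by (metis length_Cons psi_word.simps(2) comp_apply)

lemma finite_adj: "finite {y. adj q n x y}"
  by (rule finite_subset [OF _ finite_V [of q n]]) (auto dest: adj_in_V)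

section \<open>The gasket and its cells\<close>

lemma V_subset_gasket: "V q n \<subseteq> gasket q"
  unfolding gasket_def using closure_subset by fastforce

lemma closed_gasket: "closed (gasket q)"
  by (simp add: gasket_def)

lemma psi_gasket: "psi q i ` gasket q \<subseteq> gasket q"
  unfolding gasket_def
proof (rule image_closure_subset [OF continuous_on_psi closed_closure])
  have "psi q i ` (\<Union>n. V q n) \<subseteq> (\<Union>n. V q n)"
    using V_Suc_iff by blast
  then show "psi q i ` (\<Union>n. V q n) \<subseteq> closure (\<Union>n. V q n)"
    using closure_subset by blast
qed

lemma psi_word_gasket: "x \<in> gasket q \<Longrightarrow> psi_word q w x \<in> gasket q"
proof (induction w)
  case (Cons i w)
  then show ?case using psi_gasket [of q i] by auto
qed simp

definition cell :: "(3 \<Rightarrow> real^2) \<Rightarrow> 3 list \<Rightarrow> (real^2) set" where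
  "cell q w = psi_word q w ` gasket q"

lemma cell_subset_gasket: "cell q w \<subseteq> gasket q"
  by (auto simp: cell_def psi_word_gasket)

lemma vertex_in_gasket: "q i \<in> gasket q"
  using V_subset_gasket vertex_in_V by blast

lemma vertex_in_cell: "psi_word q w (q i) \<in> cell q w"
  by (simp add: cell_def vertex_in_gasket)

text \<open>Each side of the triangle is the union of its images under two of the similarities, so vertices
  of level \<open>n\<close> are met on it at scale \<^term>\<open>mesh n\<close>. Hence the sides lie in the gasket,
  and adjacent vertices are joined inside the gasket by straight segments.\<close>

lemma dense_segment:
  assumes "z \<in> closed_segment (q i) (q j)"
  shows "\<exists>v\<in>V q n. dist z v \<le> mesh n * dist (q i) (q j)"
  using assms
proof (induction n arbitrary: z)
  case 0
  have "dist z (q i) \<le> dist (q i) (q j)"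
    using 0 by (metis dist_commute dist_in_closed_segment(1))
  then show ?case by (auto simp: V_0 mesh_def)
next
  case (Suc n)
  obtain t where t: "0 \<le> t" "t \<le> 1" and z: "z = (1 - t) *\<^sub>R q i + t *\<^sub>R q j"
    using Suc.prems by (auto simp: closed_segment_def)
  \<comment> \<open>Each half of a side is the image of the whole side.\<close>
  have "\<exists>k. \<exists>y\<in>closed_segment (q i) (q j). z = psi q k y"
  proof (cases "t \<le> 1/2")
    case True
    let ?y = "(1 - 2*t) *\<^sub>R q i + (2*t) *\<^sub>R q j"
    have "?y \<in> closed_segment (q i) (q j)"
      using t True unfolding closed_segment_def by auto
    moreover have "z = psi q i ?y"
      by (simp add: z psi_midpoint algebra_simps flip: scaleR_add_left)
    ultimately show ?thesis by blast
  next
    case False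
    let ?y = "(1 - (2*t-1)) *\<^sub>R q i + (2*t-1) *\<^sub>R q j"
    have "?y \<in> closed_segment (q i) (q j)"
      using t False unfolding closed_segment_def
      by (intro CollectI exI [of _ "2*t-1"]) auto
    moreover have "z = psi q j ?y"
      by (simp add: z psi_midpoint algebra_simps flip: scaleR_add_left)
    ultimately show ?thesis by blast
  qed
  then obtain k y where y: "y \<in> closed_segment (q i) (q j)" "z = psi q k y" by blast
  obtain v where v: "v \<in> V q n" "dist y v \<le> mesh n * dist (q i) (q j)"
    using Suc.IH y(1) by blast
  have "dist z (psi q k v) = dist y v / 2"
    using dist_psi_word [of q "[k]" y v] y(2) by (simp add: mesh_def)
  then show ?case
    using v V_Suc_iff by (intro bexI [of _ "psi q k v"]) (auto simp: mesh_Suc)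
qed

lemma side_subset_gasket: "closed_segment (q i) (q j) \<subseteq> gasket q"
proof
  fix z assume z: "z \<in> closed_segment (q i) (q j)"
  show "z \<in> gasket q"
    unfolding gasket_def closure_approachable
  proof (intro allI impI)
    fix e :: real assume "0 < e"
    have "(\<lambda>n. mesh n * dist (q i) (q j)) \<longlonglongrightarrow> 0"
      unfolding mesh_def using LIMSEQ_divide_realpow_zero [of 2 "dist (q i) (q j)"] by simp
    then have "\<forall>\<^sub>F n in sequentially. mesh n * dist (q i) (q j) < e"
      using \<open>0 < e\<close> by (rule order_tendstoD)
    then obtain n where "mesh n * dist (q i) (q j) < e"
      by (auto simp: eventually_sequentially)
    then show "\<exists>y\<in>\<Union> (range (V q)). dist y z < e"
      using dense_segment [OF z, of n] by (metis UN_iff UNIV_I dist_commute order_le_less_trans)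
  qed
qed

lemma side_subset_cell:
  "closed_segment (psi_word q w (q i)) (psi_word q w (q j)) \<subseteq> cell q w"
  unfolding cell_def by (metis image_mono psi_word_segment side_subset_gasket)

text \<open>Every vertex is joined to a corner by a chain of sides of smaller and smaller triangles, so
  a dense subset of the gasket lies in one component, and components of a closed set are closed.\<close>

lemma connected_gasket: "connected (gasket q)"
proof -
  let ?C = "connected_component_set (gasket q) (q 1)"
  have side: "connected_component (gasket q) (q i) (q j)" for i j
    unfolding connected_component_def
    by (meson connected_segment ends_in_segment side_subset_gasket)
  have "connected_component (gasket q) (q 1) x" if "x \<in> V q n" for x n
    using that
  proof (induction n arbitrary: x)
    case 0
    then show ?case using side by (auto simp: V_0)
  next
    case (Suc n)
    then obtain k y where y: "y \<in> V q n" "x = psi q k y" by (auto simp: V_Suc_iff)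
    then obtain T where T: "connected T" "T \<subseteq> gasket q" "q 1 \<in> T" "y \<in> T"
      using Suc.IH [OF y(1)] by (auto simp: connected_component_def)
    have "connected (psi q k ` T)" "psi q k ` T \<subseteq> gasket q"
      using T psi_gasket connected_continuous_image [OF continuous_on_psi] by blast+
    then have "connected_component (gasket q) (psi q k (q 1)) x"
      unfolding connected_component_def using T y by blast
    moreover have "psi q k (q 1) \<in> closed_segment (q k) (q 1)"
      unfolding closed_segment_def
      by (auto simp: psi_midpoint add.commute intro!: exI [of _ "1/2"])
    then have "connected_component (gasket q) (q k) (psi q k (q 1))"
      unfolding connected_component_def
      by (meson connected_segment ends_in_segment side_subset_gasket)
    ultimately show ?case using side connected_component_trans by metis
  qed
  then have "(\<Union>n. V q n) \<subseteq> ?C" by blast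
  then have "gasket q \<subseteq> ?C"
    unfolding gasket_def [of q]
    by (intro closure_minimal) (simp_all add: closed_connected_component closed_gasket [unfolded gasket_def])
  then show ?thesis
    by (metis connected_component_subset connected_connected_component subset_antisym)
qed

section \<open>Barycentric coordinates\<close>

text \<open>The coordinates are written with inner products, so that they are affine functions on the whole
  plane; for an equilateral triangle of side 1 they are the barycentric ones.\<close>

definition bary :: "(3 \<Rightarrow> real^2) \<Rightarrow> 3 \<Rightarrow> real^2 \<Rightarrow> real" where
  "bary q i x = 1 - 2/3 * (\<Sum>j\<in>UNIV. (q i - x) \<bullet> (q i - q j))"

text \<open>The triangle with its interior, described by the properties of the coordinates that pass through
  the maps \<^term>\<open>psi q j\<close> and survive limits.\<close>

definition solid_triangle :: "(3 \<Rightarrow> real^2) \<Rightarrow> (real^2) set" where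
  "solid_triangle q = {x. (\<forall>i. 0 \<le> bary q i x) \<and> (\<Sum>i\<in>UNIV. bary q i x) = 1 \<and>
                    x = (\<Sum>i\<in>UNIV. bary q i x *\<^sub>R q i)}"

lemma closed_solid_triangle: "closed (solid_triangle q)"
proof -
  have "solid_triangle q = (\<Inter>i. {x. 0 \<le> bary q i x}) \<inter> {x. (\<Sum>i\<in>UNIV. bary q i x) = 1} \<inter>
      {x. x = (\<Sum>i\<in>UNIV. bary q i x *\<^sub>R q i)}"
    unfolding solid_triangle_def by blast
  moreover have "continuous_on UNIV (\<lambda>x. bary q i x)" for i
    unfolding bary_def by (intro continuous_intros)
  ultimately show ?thesis
    by (auto intro!: closed_Int closed_INT closed_Collect_le closed_Collect_eq continuous_intros)
qed

lemma bary_psi_raw: "bary q i (psi q j x) = (bary q i x + bary q i (q j)) / 2"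
proof -
  have "(q i - psi q j x) \<bullet> v = ((q i - x) \<bullet> v + (q i - q j) \<bullet> v) / 2" for v
    by (simp add: psi_midpoint inner_diff_left inner_add_left)
  then show ?thesis
    by (simp add: bary_def sum.distrib add_divide_distrib diff_divide_distrib ring_distribs
             flip: sum_divide_distrib)
qed

locale equilateral =
  fixes q :: "3 \<Rightarrow> real^2"
  assumes unit_triangle: "unit_triangle q"
begin

lemma dist_vertices: "dist (q i) (q j) = of_bool (i \<noteq> j)"
  using unit_triangle by (simp add: unit_triangle_def)

lemma inner_vertices:
  "(q i - q k) \<bullet> (q i - q j) = (of_bool (i \<noteq> k) + of_bool (i \<noteq> j) - of_bool (k \<noteq> j)) / 2"
proof -
  have "(q i - q k) - (q i - q j) = q j - q k" by simp
  then show ?thesis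
    using dist_vertices [of i k] dist_vertices [of i j] dist_vertices [of k j]
    by (simp add: dot_norm_neg dist_norm norm_minus_commute [of "q k" "q j"])
qed

lemma bary_vertex: "bary q i (q k) = of_bool (i = k)"
proof -
  have *: "(\<Sum>j\<in>(UNIV :: 3 set). of_bool (i \<noteq> j)) = (2::real)" for i
  proof -
    have "(\<Sum>j\<in>(UNIV :: 3 set). of_bool (i \<noteq> j)) = real (card (UNIV - {i}))"
      by (simp add: of_bool_def sum.If_cases Collect_neg_eq Compl_eq_Diff_UNIV Int_def)
    then show ?thesis by (simp add: card_Diff_singleton)
  qed
  have "(\<Sum>j\<in>UNIV. (q i - q k) \<bullet> (q i - q j)) = 3/2 * of_bool (i \<noteq> k)"
    by (simp add: inner_vertices sum.distrib sum_subtractf * flip: sum_divide_distrib)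
  then show ?thesis by (cases "i = k") (simp_all add: bary_def)
qed

lemma bary_psi: "bary q i (psi q j x) = (bary q i x + of_bool (i = j)) / 2"
  by (simp add: bary_psi_raw bary_vertex)

lemma vertex_in_triangle: "q k \<in> solid_triangle q"
  by (simp add: solid_triangle_def bary_vertex of_bool_def if_distrib [of "\<lambda>c. c *\<^sub>R _"] cong: if_cong)

lemma psi_triangle:
  assumes "x \<in> solid_triangle q" shows "psi q j x \<in> solid_triangle q"
proof -
  have x: "\<And>i. 0 \<le> bary q i x" "(\<Sum>i\<in>UNIV. bary q i x) = 1"
     "(\<Sum>i\<in>UNIV. bary q i x *\<^sub>R q i) = x"
    using assms by (auto simp: solid_triangle_def)
  have j: "(\<Sum>i\<in>UNIV. of_bool (i = j)) = (1::real)" "(\<Sum>i\<in>UNIV. of_bool (i = j) *\<^sub>R q i) = q j"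
    by (simp_all add: of_bool_def if_distrib [of "\<lambda>c. c *\<^sub>R _"] cong: if_cong)
  have "(\<Sum>i\<in>UNIV. bary q i (psi q j x) *\<^sub>R q i) =
     (\<Sum>i\<in>UNIV. (1/2) *\<^sub>R (bary q i x *\<^sub>R q i) + (1/2) *\<^sub>R (of_bool (i = j) *\<^sub>R q i))"
    by (simp add: bary_psi scaleR_add_left add_divide_distrib)
  also have "\<dots> = (1/2) *\<^sub>R (\<Sum>i\<in>UNIV. bary q i x *\<^sub>R q i) +
      (1/2) *\<^sub>R (\<Sum>i\<in>UNIV. of_bool (i = j) *\<^sub>R q i)"
    by (simp only: sum.distrib scaleR_right.sum)
  also have "\<dots> = psi q j x"
    by (simp only: x j psi_midpoint)
  finally have "psi q j x = (\<Sum>i\<in>UNIV. bary q i (psi q j x) *\<^sub>R q i)" ..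
  moreover have "(\<Sum>i\<in>UNIV. bary q i (psi q j x)) = 1"
    by (simp add: bary_psi sum.distrib x j flip: sum_divide_distrib)
  moreover have "0 \<le> bary q i (psi q j x)" for i
    using x(1) by (simp add: bary_psi)
  ultimately show ?thesis unfolding solid_triangle_def by blast
qed

lemma gasket_subset_triangle: "gasket q \<subseteq> solid_triangle q"
proof -
  have "x \<in> solid_triangle q" if "x \<in> V q n" for x n
    using that by (induction n arbitrary: x) (auto simp: V_0 V_Suc_iff vertex_in_triangle psi_triangle)
  then show ?thesis
    unfolding gasket_def by (intro closure_minimal closed_solid_triangle) blast
qed

lemma triangle_point: "x \<in> solid_triangle q \<Longrightarrow> x = (\<Sum>i\<in>UNIV. bary q i x *\<^sub>R q i)"
  and triangle_bary_nonneg: "x \<in> solid_triangle q \<Longrightarrow> 0 \<le> bary q i x"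
  and triangle_bary_sum: "x \<in> solid_triangle q \<Longrightarrow> (\<Sum>i\<in>UNIV. bary q i x) = 1"
  by (auto simp: solid_triangle_def)

lemma triangle_eqI:
  assumes "x \<in> solid_triangle q" "y \<in> solid_triangle q" "\<And>i. bary q i x = bary q i y"
  shows "x = y"
  using triangle_point [OF assms(1)] triangle_point [OF assms(2)] assms(3) by simp

lemma triangle_bary_le1:
  assumes "x \<in> solid_triangle q" shows "bary q i x \<le> 1"
proof -
  have "bary q i x \<le> (\<Sum>i\<in>UNIV. bary q i x)"
    by (rule member_le_sum) (use assms in \<open>auto simp: solid_triangle_def\<close>)
  then show ?thesis using triangle_bary_sum [OF assms] by simp
qed

lemma bary_one_imp_vertex:
  assumes "x \<in> solid_triangle q" "bary q i x = 1" shows "x = q i"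
proof (rule triangle_eqI [OF assms(1) vertex_in_triangle])
  fix j
  show "bary q j x = bary q j (q i)"
  proof (cases "j = i")
    case False
    have "(\<Sum>k\<in>{i,j}. bary q k x) \<le> (\<Sum>k\<in>UNIV. bary q k x)"
      by (rule sum_mono2) (use assms in \<open>auto simp: solid_triangle_def\<close>)
    then show ?thesis
      using False assms triangle_bary_sum triangle_bary_nonneg [OF assms(1), of j]
      by (simp add: bary_vertex)
  qed (simp add: assms bary_vertex)
qed

lemma bary_halves_imp_midpoint:
  assumes "x \<in> solid_triangle q" "i \<noteq> j" "1/2 \<le> bary q i x" "1/2 \<le> bary q j x"
  shows "x = psi q i (q j)"
proof (rule triangle_eqI [OF assms(1) psi_triangle [OF vertex_in_triangle]])
  fix k
  have "(\<Sum>l\<in>insert k {i,j}. bary q l x) \<le> (\<Sum>l\<in>UNIV. bary q l x)"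
    by (rule sum_mono2) (use assms in \<open>auto simp: solid_triangle_def\<close>)
  then show "bary q k x = bary q k (psi q i (q j))"
    using assms(2-4) triangle_bary_sum [OF assms(1)] triangle_bary_nonneg [OF assms(1), of k]
    by (cases "k = i"; cases "k = j") (auto simp: bary_psi bary_vertex insert_absorb)
qed

lemma dist_vertex_le1:
  assumes "x \<in> solid_triangle q" shows "dist (q k) x \<le> 1"
proof -
  have "q k - x = (\<Sum>i\<in>UNIV. bary q i x *\<^sub>R (q k - q i))"
    by (simp add: scaleR_diff_right sum_subtractf triangle_bary_sum [OF assms]
        triangle_point [OF assms, symmetric] flip: scaleR_left.sum)
  also have "norm \<dots> \<le> (\<Sum>i\<in>UNIV. norm (bary q i x *\<^sub>R (q k - q i)))"
    by (rule norm_sum)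
  also have "\<dots> \<le> (\<Sum>i\<in>UNIV. bary q i x)"
    using triangle_bary_nonneg [OF assms] dist_vertices [unfolded dist_norm]
    by (intro sum_mono) (simp add: mult_left_le)
  finally show ?thesis by (simp add: dist_norm triangle_bary_sum [OF assms])
qed

text \<open>The difference of two points is a combination of \<open>q 3 - q 1\<close> and \<open>q 3 - q 2\<close>, which are
  unit vectors with inner product \<open>1/2\<close>.\<close>

lemma dist_triangle_sq:
  assumes "x \<in> solid_triangle q" "y \<in> solid_triangle q"
  defines "d \<equiv> \<lambda>i. bary q i x - bary q i y"
  shows "(dist x y)\<^sup>2 = (d 1)\<^sup>2 + d 1 * d 2 + (d 2)\<^sup>2"
proof -
  have d3: "d 3 = - d 1 - d 2"
    using triangle_bary_sum [OF assms(1)] triangle_bary_sum [OF assms(2)]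
    by (simp add: d_def sum_3)
  have "x - y = d 1 *\<^sub>R q 1 + d 2 *\<^sub>R q 2 + d 3 *\<^sub>R q 3"
    using triangle_point [OF assms(1)] triangle_point [OF assms(2)]
    by (simp add: d_def sum_3 scaleR_diff_left algebra_simps)
  also have "\<dots> = (- d 1) *\<^sub>R (q 3 - q 1) + (- d 2) *\<^sub>R (q 3 - q 2)"
    by (simp add: d3 algebra_simps)
  finally have xy: "x - y = (- d 1) *\<^sub>R (q 3 - q 1) + (- d 2) *\<^sub>R (q 3 - q 2)" .
  have "(dist x y)\<^sup>2 = (x - y) \<bullet> (x - y)"
    by (simp add: dist_norm power2_norm_eq_inner)
  also have "\<dots> = (d 1)\<^sup>2 * ((q 3 - q 1) \<bullet> (q 3 - q 1)) + d 1 * d 2 * ((q 3 - q 1) \<bullet> (q 3 - q 2)) +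
      d 1 * d 2 * ((q 3 - q 2) \<bullet> (q 3 - q 1)) + (d 2)\<^sup>2 * ((q 3 - q 2) \<bullet> (q 3 - q 2))"
    unfolding xy by (simp only: inner_add_left inner_add_right inner_scaleR_left inner_scaleR_right)
       (simp add: power2_eq_square algebra_simps)
  finally have "(dist x y)\<^sup>2 = (d 1)\<^sup>2 * ((q 3 - q 1) \<bullet> (q 3 - q 1)) + d 1 * d 2 * ((q 3 - q 1) \<bullet> (q 3 - q 2)) +
      d 1 * d 2 * ((q 3 - q 2) \<bullet> (q 3 - q 1)) + (d 2)\<^sup>2 * ((q 3 - q 2) \<bullet> (q 3 - q 2))" .
  then show ?thesis by (simp add: inner_vertices)
qed

lemma bary_dyadic: "x \<in> V q n \<Longrightarrow> \<exists>m::int. bary q i x = m * mesh n"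
proof (induction n arbitrary: x)
  case 0
  then show ?case by (auto simp: V_0 bary_vertex mesh_def intro: exI [of _ "of_bool _"])
next
  case (Suc n)
  then obtain j y where y: "y \<in> V q n" "x = psi q j y" by (auto simp: V_Suc_iff)
  obtain m :: int where "bary q i y = m * mesh n" using Suc.IH [OF y(1)] by blast
  then have "bary q i x = (m + of_bool (i = j) * 2 ^ n :: int) * mesh (Suc n)"
    by (simp add: y(2) bary_psi mesh_def field_simps)
  then show ?case by blast
qed

lemma V_subset_triangle: "V q n \<subseteq> solid_triangle q"
  using V_subset_gasket gasket_subset_triangle by blast

text \<open>The coordinates of vertices of level \<open>n\<close> are integer multiples of the mesh size, and the form
  \<open>a\<^sup>2 + a * b + b\<^sup>2\<close> takes values at least 1 at nonzero integer vectors. This is what makes the second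
  ring of neighbours of a vertex lie at distance two meshes along every curve.\<close>

lemma V_separated:
  assumes "x \<in> V q n" "y \<in> V q n" "x \<noteq> y"
  shows "mesh n \<le> dist x y"
proof -
  have tri: "x \<in> solid_triangle q" "y \<in> solid_triangle q"
    using assms V_subset_triangle by auto
  have "\<exists>m::int. bary q i x - bary q i y = m * mesh n" for i
  proof -
    obtain k l :: int where "bary q i x = k * mesh n" "bary q i y = l * mesh n"
      using bary_dyadic [OF assms(1), of i] bary_dyadic [OF assms(2), of i] by blast
    then have "bary q i x - bary q i y = (k - l :: int) * mesh n"
      by (simp add: left_diff_distrib)
    then show ?thesis by blast
  qed
  then have "\<forall>i. \<exists>m::int. bary q i x - bary q i y = m * mesh n" by blast
  from choice [OF this] obtain m :: "3 \<Rightarrow> int"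
    where m: "\<And>i. bary q i x - bary q i y = m i * mesh n" by blast
  have "m 1 \<noteq> 0 \<or> m 2 \<noteq> 0"
  proof (rule ccontr)
    assume "\<not> ?thesis"
    then have "(dist x y)\<^sup>2 = 0" using dist_triangle_sq [OF tri] m by simp
    with assms show False by simp
  qed
  then have "0 < 2 * ((m 1)\<^sup>2 + m 1 * m 2 + (m 2)\<^sup>2)"
  proof -
    have "2 * ((m 1)\<^sup>2 + m 1 * m 2 + (m 2)\<^sup>2) = (m 1)\<^sup>2 + (m 2)\<^sup>2 + (m 1 + m 2)\<^sup>2"
      by (simp add: power2_eq_square algebra_simps)
    moreover have "0 < (m 1)\<^sup>2 + (m 2)\<^sup>2"
      using \<open>m 1 \<noteq> 0 \<or> m 2 \<noteq> 0\<close> by (simp add: sum_power2_gt_zero_iff)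
    moreover have "0 \<le> (m 1 + m 2)\<^sup>2" by simp
    ultimately show ?thesis by linarith
  qed
  then have "1 \<le> (m 1)\<^sup>2 + m 1 * m 2 + (m 2)\<^sup>2" by simp
  then have "1 \<le> real_of_int ((m 1)\<^sup>2 + m 1 * m 2 + (m 2)\<^sup>2)"
    by (simp only: of_int_1_le_iff)
  then have "(mesh n)\<^sup>2 * 1 \<le> (mesh n)\<^sup>2 * real_of_int ((m 1)\<^sup>2 + m 1 * m 2 + (m 2)\<^sup>2)"
    by (intro mult_left_mono) auto
  also have "\<dots> = (dist x y)\<^sup>2"
    unfolding dist_triangle_sq [OF tri] m by (simp add: power2_eq_square algebra_simps)
  finally have "(mesh n)\<^sup>2 \<le> (dist x y)\<^sup>2" by simp
  then show ?thesis by (rule power2_le_imp_le) simp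
qed

lemma adj_dist:
  assumes "adj q n x y" shows "dist x y = mesh n"
  using assms by (auto simp: adj_iff dist_psi_word dist_vertices)

lemma adj_neq: "adj q n x y \<Longrightarrow> x \<noteq> y"
  using adj_dist mesh_pos by (metis dist_self less_irrefl)

lemma bary_psi_word_diff:
  "bary q i (psi_word q w x) - bary q i (psi_word q w y) =
   mesh (length w) * (bary q i x - bary q i y)"
  by (induction w) (simp_all add: bary_psi mesh_def field_simps)

lemma bary_adj:
  assumes "adj q n x y" shows "bary q i x - mesh n \<le> bary q i y"
proof -
  obtain w j k where w: "length w = n" "j \<noteq> k"
    and xy: "x = psi_word q w (q j)" "y = psi_word q w (q k)"
    using assms by (auto simp: adj_iff)
  have "bary q i x - bary q i y = mesh n * (bary q i (q j) - bary q i (q k))"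
    using w by (simp add: xy bary_psi_word_diff)
  also have "\<dots> \<le> mesh n * 1"
    by (intro mult_left_mono) (auto simp: bary_vertex less_imp_le)
  finally show ?thesis by simp
qed

text \<open>Every vertex other than \<^term>\<open>q i\<close> lies in a cell of which it is not the vertex nearest to
  \<^term>\<open>q i\<close>. This single fact provides neighbours, shows that no nonempty set of interior vertices is closed under
  adjacency, and makes \<^term>\<open>bary q i\<close> a barrier at \<^term>\<open>q i\<close>.\<close>

lemma adj_towards_vertex:
  assumes "x \<in> V q n" "x \<noteq> q i"
  shows "\<exists>y. adj q n x y \<and> bary q i y = bary q i x + mesh n"
  using assms
proof (induction n arbitrary: x)
  case 0
  then obtain j where "x = q j" "j \<noteq> i" by (auto simp: V_0)
  then show ?case
    by (intro exI [of _ "q i"])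
       (auto simp: adj_iff bary_vertex mesh_def intro!: exI [of _ "[]"])
next
  case (Suc n)
  then obtain j x' where x': "x' \<in> V q n" "x = psi q j x'" by (auto simp: V_Suc_iff)
  \<comment> \<open>If \<open>x\<close> is the vertex \<open>q i\<close> of the subtriangle \<open>j\<close>, it is also the vertex \<open>q j\<close> of the subtriangle \<open>i\<close>.\<close>
  have "\<exists>j x'. x' \<in> V q n \<and> x = psi q j x' \<and> x' \<noteq> q i"
  proof (cases "x' = q i")
    case True
    then have "x = psi q i (q j)" "j \<noteq> i"
      using x' Suc.prems psi_commute by auto
    moreover have "q j \<noteq> q i" using \<open>j \<noteq> i\<close> dist_vertices [of j i] by auto
    ultimately show ?thesis using vertex_in_V by metis
  qed (use x' in blast)
  then obtain j x' where x': "x' \<in> V q n" "x = psi q j x'" "x' \<noteq> q i" by blast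
  then obtain y where y: "adj q n x' y" "bary q i y = bary q i x' + mesh n"
    using Suc.IH by blast
  then show ?case
    by (intro exI [of _ "psi q j y"]) (auto simp: x' adj_psi bary_psi mesh_Suc field_simps)
qed

lemma gasket_subset_vertex_cball: "gasket q \<subseteq> cball (q k) 1"
  using gasket_subset_triangle dist_vertex_le1 by auto

lemma compact_gasket: "compact (gasket q)"
  using gasket_subset_vertex_cball bounded_subset bounded_cball closed_gasket
  by (metis compact_eq_bounded_closed)

lemma compact_cell: "compact (cell q w)"
  unfolding cell_def by (intro compact_continuous_image continuous_on_psi_word compact_gasket)

lemma closed_cell: "closed (cell q w)"
  by (simp add: compact_cell compact_imp_closed)

lemma connected_cell: "connected (cell q w)"
  unfolding cell_def by (intro connected_continuous_image continuous_on_psi_word connected_gasket)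

lemma gasket_self_similar: "x \<in> gasket q \<Longrightarrow> \<exists>i. x \<in> psi q i ` gasket q"
proof -
  have "closed (\<Union>i. psi q i ` gasket q)"
    by (intro closed_UN) (auto intro!: compact_imp_closed compact_continuous_image
        continuous_on_psi compact_gasket)
  moreover have "(\<Union>n. V q n) \<subseteq> (\<Union>i. psi q i ` gasket q)"
  proof clarify
    fix x n assume "x \<in> V q n"
    then have "x \<in> V q (Suc n)" by (rule V_mono_Suc)
    then show "x \<in> (\<Union>i. psi q i ` gasket q)"
      using V_subset_gasket by (fastforce simp: V_Suc_iff)
  qed
  ultimately have "closure (\<Union>n. V q n) \<subseteq> (\<Union>i. psi q i ` gasket q)"
    by (intro closure_minimal)
  then show "x \<in> gasket q \<Longrightarrow> \<exists>i. x \<in> psi q i ` gasket q"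
    unfolding gasket_def [symmetric] by blast
qed

lemma in_some_cell: "x \<in> gasket q \<Longrightarrow> \<exists>w. length w = n \<and> x \<in> cell q w"
proof (induction n arbitrary: x)
  case 0
  then show ?case by (simp add: cell_def)
next
  case (Suc n)
  then obtain i y where y: "y \<in> gasket q" "x = psi q i y"
    using gasket_self_similar by blast
  then obtain w where "length w = n" "y \<in> cell q w" using Suc.IH by blast
  then have "length (i # w) = Suc n" "x \<in> cell q (i # w)"
    by (auto simp: y cell_def)
  then show ?case by blast
qed

lemma cell_Cons: "cell q (i # w) = psi q i ` cell q w"
  by (simp add: cell_def image_comp)

text \<open>The point \<^term>\<open>q k\<close> is the only one of the triangle with \<^term>\<open>bary q k\<close> equal to 1, and
  a map \<^term>\<open>psi q i\<close> attains this value only for \<open>i = k\<close> and at \<^term>\<open>q k\<close>.\<close>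

lemma corner_in_cell:
  "q k \<in> cell q w \<Longrightarrow> q k = psi_word q w (q k)"
proof (induction w)
  case (Cons i w)
  then obtain y where y: "y \<in> cell q w" "q k = psi q i y" by (auto simp: cell_Cons)
  have tri: "y \<in> solid_triangle q"
    using y(1) cell_subset_gasket gasket_subset_triangle by blast
  have "(bary q k y + of_bool (k = i)) / 2 = 1"
    unfolding bary_psi [symmetric] y(2) [symmetric] by (simp add: bary_vertex)
  then have "k = i" "bary q k y = 1"
    using triangle_bary_le1 [OF tri, of k] by (auto simp: of_bool_def split: if_splits)
  then have "y = q k" using bary_one_imp_vertex tri by blast
  moreover have "q i = psi_word q w (q i)"
    using Cons.IH y(1) calculation \<open>k = i\<close> by simp
  ultimately show ?case using \<open>k = i\<close> by (metis psi_vertex psi_word.simps(2) comp_apply)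
qed simp

text \<open>Cells touch only at vertices: at the first letter where the words differ, the common point has
  two barycentric coordinates at least \<open>1/2\<close>, hence it is the midpoint of a side.\<close>

lemma cell_Int_vertex:
  assumes "length w = length w'" "w \<noteq> w'" "p \<in> cell q w" "p \<in> cell q w'"
  shows "\<exists>i. p = psi_word q w (q i)"
  using assms
proof (induction w w' arbitrary: p rule: list_induct2)
  case (Cons i w j w')
  obtain y where y: "y \<in> cell q w" "p = psi q i y"
    using Cons.prems by (auto simp: cell_Cons)
  obtain z where z: "z \<in> cell q w'" "p = psi q j z"
    using Cons.prems by (auto simp: cell_Cons)
  have tri: "y \<in> solid_triangle q" "z \<in> solid_triangle q"
    using y z cell_subset_gasket gasket_subset_triangle by blast+
  show ?case
  proof (cases "i = j")
    case True
    then have "y = z" using y z inj_psi by simp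
    then obtain k where "y = psi_word q w (q k)"
      using Cons.IH [of y] Cons.prems True y z by auto
    then show ?thesis using y by auto
  next
    case False
    have "1/2 \<le> bary q i p" "1/2 \<le> bary q j p"
      using triangle_bary_nonneg tri by (simp add: y(2) bary_psi, simp add: z(2) bary_psi)
    then have "p = psi q i (q j)"
      using bary_halves_imp_midpoint False psi_triangle tri(1) y(2) by blast
    then have "y = q j" using y inj_psi by simp
    then have "y = psi_word q w (q j)" using corner_in_cell y by simp
    then show ?thesis using y by auto
  qed
qed simp

lemma V_in_cell:
  assumes "p \<in> V q n" "p \<in> cell q w" "length w = n"
  shows "\<exists>i. p = psi_word q w (q i)"
proof -
  obtain w' i where w': "length w' = n" "p = psi_word q w' (q i)"
    using assms by (auto simp: V_iff)
  then show ?thesis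
    using cell_Int_vertex [of w w' p] assms vertex_in_cell by metis
qed

lemma V_in_cell_adj:
  assumes "x \<in> V q n" "y \<in> V q n" "x \<in> cell q w" "y \<in> cell q w" "length w = n" "x \<noteq> y"
  shows "adj q n x y"
  using V_in_cell [OF assms(1,3,5)] V_in_cell [OF assms(2,4,5)] assms(5,6)
  unfolding adj_iff by metis

lemma dist_cell_vertex:
  assumes "x \<in> V q n" "x \<in> cell q w" "z \<in> cell q w" "length w = n"
  shows "dist x z \<le> mesh n"
proof -
  obtain i where i: "x = psi_word q w (q i)" using V_in_cell assms by blast
  obtain s where s: "s \<in> gasket q" "z = psi_word q w s" using assms by (auto simp: cell_def)
  have "dist (q i) s \<le> 1" using gasket_subset_vertex_cball [of i] s by auto
  then show ?thesis
    by (simp add: i s dist_psi_word assms mult_left_le less_imp_le)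
qed

lemma dist_cell:
  assumes "y \<in> cell q w" "z \<in> cell q w"
  shows "dist y z \<le> 2 * mesh (length w)"
proof -
  let ?v = "psi_word q w (q 1)"
  have "dist ?v y \<le> mesh (length w)" "dist ?v z \<le> mesh (length w)"
    by (rule dist_cell_vertex [where w = w]; use assms vertex_in_cell V_iff in blast)+
  then show ?thesis using dist_triangle3 [of y z ?v] by linarith
qed

text \<open>The cells that miss a set of vertices form a closed set, whose complement serves as an open
  neighbourhood of these vertices made of cells.\<close>

definition cells_missing :: "nat \<Rightarrow> (real^2) set \<Rightarrow> (real^2) set" where
  "cells_missing n K = (\<Union>w\<in>{w. length w = n \<and> cell q w \<inter> K = {}}. cell q w)"

definition cells_meeting :: "nat \<Rightarrow> (real^2) set \<Rightarrow> (real^2) set" where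
  "cells_meeting n K = (\<Union>w\<in>{w. length w = n \<and> cell q w \<inter> K \<noteq> {}}. cell q w)"

lemma finite_words: "finite {w :: 3 list. length w = n \<and> P w}"
  by (rule finite_subset [OF _ finite_lists_length_eq [of "UNIV :: 3 set" n]]) auto

lemma closed_cells_missing: "closed (cells_missing n K)"
  unfolding cells_missing_def by (intro closed_UN finite_words) (simp add: closed_cell)

lemma closed_cells_meeting: "closed (cells_meeting n K)"
  unfolding cells_meeting_def by (intro closed_UN finite_words) (simp add: closed_cell)

lemma gasket_eq_cells: "gasket q = cells_meeting n K \<union> cells_missing n K"
proof
  show "gasket q \<subseteq> cells_meeting n K \<union> cells_missing n K"
    using in_some_cell [of _ n] by (force simp: cells_meeting_def cells_missing_def)
  show "cells_meeting n K \<union> cells_missing n K \<subseteq> gasket q"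
    using cell_subset_gasket by (auto simp: cells_meeting_def cells_missing_def)
qed

text \<open>Cells of small diameter are connected, and those containing a point form a neighbourhood of it. Local
  connectedness is needed so that components of open sets are open, and hence admissible in the definition of
  \<^const>\<open>gAMLE\<close>.\<close>

lemma locally_connected_gasket: "locally connected (gasket q)"
  unfolding locally_connected_im_kleinen
proof (intro allI impI, elim conjE)
  fix U x assume U: "openin (gtop q) U" and x: "x \<in> U"
  have xg: "x \<in> gasket q" using U x openin_imp_subset by blast
  obtain e where e: "0 < e" "\<And>y. y \<in> gasket q \<Longrightarrow> dist y x < e \<Longrightarrow> y \<in> U"
    using U x unfolding openin_euclidean_subtopology_iff by blast
  have "(\<lambda>n. 2 * mesh n) \<longlonglongrightarrow> 0"
    unfolding mesh_def using LIMSEQ_divide_realpow_zero [of 2 2] by simp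
  then have "\<forall>\<^sub>F n in sequentially. 2 * mesh n < e" using e(1) by (rule order_tendstoD)
  then obtain n where n: "2 * mesh n < e" by (auto simp: eventually_sequentially)
  let ?u = "gasket q - cells_missing n {x}"
  have cellU: "cell q w \<subseteq> U" if "x \<in> cell q w" "length w = n" for w
  proof
    fix y assume "y \<in> cell q w"
    then have "dist y x < e" using dist_cell that n by fastforce
    then show "y \<in> U" using e \<open>y \<in> cell q w\<close> cell_subset_gasket by blast
  qed
  have cell: "\<exists>w. length w = n \<and> x \<in> cell q w \<and> y \<in> cell q w" if "y \<in> ?u" for y
    using that gasket_eq_cells [of n "{x}"] by (auto simp: cells_meeting_def)
  show "\<exists>V. openin (gtop q) V \<and> x \<in> V \<and> V \<subseteq> U \<and>
      (\<forall>y. y \<in> V \<longrightarrow> (\<exists>c. connected c \<and> c \<subseteq> U \<and> x \<in> c \<and> y \<in> c))"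
  proof (rule exI [of _ ?u], intro conjI allI impI)
    show "openin (gtop q) ?u"
      using openin_open_Int [of "- cells_missing n {x}" "gasket q"] closed_cells_missing
      by (simp add: Diff_eq open_Compl)
    show "x \<in> ?u" using xg by (auto simp: cells_missing_def)
    show "?u \<subseteq> U" using cell cellU by blast
    show "\<exists>c. connected c \<and> c \<subseteq> U \<and> x \<in> c \<and> y \<in> c" if "y \<in> ?u" for y
      using cell [OF that] cellU connected_cell by blast
  qed
qed

end

section \<open>Curves and the path distance\<close>

lemma curve_length_ge_via:
  assumes "0 \<le> t" "t \<le> 1"
  shows "ereal (dist (\<gamma> 0) (\<gamma> t) + dist (\<gamma> t) (\<gamma> 1)) \<le> curve_length \<gamma>"
proof -
  let ?p = "\<lambda>i::nat. if i = 0 then 0 else if i = 1 then t else (1::real)"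
  have *: "(\<Sum>i<2. dist (\<gamma> (?p i)) (\<gamma> (?p (Suc i)))) = dist (\<gamma> 0) (\<gamma> t) + dist (\<gamma> t) (\<gamma> 1)"
    by (simp add: numeral_2_eq_2)
  show ?thesis
    unfolding curve_length_def *[symmetric]
    by (intro Sup_upper CollectI exI [of _ "2::nat"] exI [of _ ?p]) (use assms in auto)
qed

lemma curve_length_linepath: "curve_length (linepath x y) \<le> ereal (dist x y)"
  unfolding curve_length_def
proof (rule Sup_least, clarify)
  fix N and t :: "nat \<Rightarrow> real"
  assume t: "t 0 = 0" "t N = 1" "\<forall>i<N. t i \<le> t (Suc i)"
  have lp: "linepath x y s - linepath x y r = (r - s) *\<^sub>R (x - y)" for s r
    by (simp add: linepath_def algebra_simps)
  have "(\<Sum>i<N. dist (linepath x y (t i)) (linepath x y (t (Suc i)))) =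
      (\<Sum>i<N. (t (Suc i) - t i) * dist x y)"
    using t(3) by (intro sum.cong) (auto simp: dist_norm lp)
  also have "\<dots> = (\<Sum>i<N. t (Suc i) - t i) * dist x y"
    by (simp add: sum_distrib_right)
  also have "\<dots> = dist x y"
    using t by (simp add: sum_lessThan_telescope)
  finally show "ereal (\<Sum>i<N. dist (linepath x y (t i)) (linepath x y (t (Suc i)))) \<le> ereal (dist x y)"
    by simp
qed

lemma gdist_le_dist:
  assumes "closed_segment x y \<subseteq> gasket q" shows "gdist q x y \<le> ereal (dist x y)"
proof -
  have "gdist q x y \<le> curve_length (linepath x y)"
    unfolding gdist_def
    by (rule Inf_lower, rule CollectI, rule exI [of _ "linepath x y"]) (use assms in auto)
  with curve_length_linepath show ?thesis by (rule order_trans [rotated])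
qed

lemma gdist_geI:
  assumes "\<And>\<gamma>. path \<gamma> \<Longrightarrow> path_image \<gamma> \<subseteq> gasket q \<Longrightarrow> pathstart \<gamma> = x \<Longrightarrow> pathfinish \<gamma> = y
      \<Longrightarrow> L \<le> curve_length \<gamma>"
  shows "L \<le> gdist q x y"
  unfolding gdist_def by (rule Inf_greatest) (use assms in auto)

lemma dist_le_gdist: "ereal (dist x y) \<le> gdist q x y"
proof (rule gdist_geI)
  fix \<gamma> :: "real \<Rightarrow> real^2" assume "pathstart \<gamma> = x" "pathfinish \<gamma> = y"
  then show "ereal (dist x y) \<le> curve_length \<gamma>"
    using curve_length_ge_via [of 0 \<gamma>] by (simp add: pathstart_def pathfinish_def)
qed

lemma gAMLE_uminus:
  assumes "u \<in> gAMLE q" shows "(\<lambda>x. - u x) \<in> gAMLE q"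
proof -
  have L: "gLip q (\<lambda>x. - f x) A = gLip q f A" for f A
    unfolding gLip_def by (simp add: abs_minus_commute)
  show ?thesis
    unfolding gAMLE_def
  proof (intro CollectI conjI allI impI)
    show "continuous_on (gasket q) (\<lambda>x. - u x)"
      using assms by (auto simp: gAMLE_def intro: continuous_intros)
    fix A v
    assume A: "A \<noteq> gasket q \<and> openin (gtop q) A \<and> connected A \<and> A \<subseteq> gasket q - V q 0 \<and>
        (\<forall>x\<in>gtop q frontier_of A. - u x = v x)"
    then have "\<forall>x\<in>gtop q frontier_of A. u x = - v x" by fastforce
    with A have "gLip q u A \<le> gLip q (\<lambda>x. - v x) A"
      using assms by (simp add: gAMLE_def)
    then show "gLip q (\<lambda>x. - u x) A \<le> gLip q v A" by (simp add: L)
  qed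
qed

section \<open>Comparison with cones on the gasket\<close>

context equilateral
begin

text \<open>The cells at \<open>x\<close> and the remaining cells meet only in neighbours of \<open>x\<close>, through which every
  curve leaving the star of \<open>x\<close> has to pass.\<close>

lemma star_link:
  assumes "x \<in> V q n" "z \<in> cells_meeting n {x}" "z \<in> cells_missing n {x}"
  shows "adj q n x z"
proof -
  obtain w where w: "length w = n" "x \<in> cell q w" "z \<in> cell q w"
    using assms by (auto simp: cells_meeting_def)
  obtain w' where w': "length w' = n" "x \<notin> cell q w'" "z \<in> cell q w'"
    using assms by (auto simp: cells_missing_def)
  obtain i where "z = psi_word q w (q i)"
    using cell_Int_vertex [of w w' z] w w' by auto
  then have "z \<in> V q n" using w V_iff by blast
  moreover have "x \<noteq> z" using w' by auto
  ultimately show ?thesis using V_in_cell_adj assms(1) w by blast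
qed

text \<open>A substitute for the path distance to \<open>x\<close> in the two rings of cells around \<open>x\<close>. Being glued from
  Euclidean distances, it is obviously continuous, and its value can be computed at all points that matter.\<close>

definition star_cone :: "nat \<Rightarrow> real^2 \<Rightarrow> real^2 \<Rightarrow> real" where
  "star_cone n x z = (if z \<in> cells_meeting n {x} then dist x z
                 else mesh n + infdist z {y. adj q n x y})"

lemma continuous_on_star_cone:
  assumes "x \<in> V q n" shows "continuous_on (gasket q) (star_cone n x)"
  unfolding star_cone_def gasket_eq_cells [of n "{x}"]
proof (rule continuous_on_cases)
  show "\<forall>z. z \<in> cells_meeting n {x} \<and> z \<notin> cells_meeting n {x} \<or>
        z \<in> cells_missing n {x} \<and> z \<in> cells_meeting n {x} \<longrightarrow>
        dist x z = mesh n + infdist z {y. adj q n x y}"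
    using star_link [OF assms] adj_dist by fastforce
qed (auto intro!: continuous_intros closed_cells_meeting closed_cells_missing)

text \<open>Inside the star of \<open>x\<close> and outside it the function is 1-Lipschitz even for the Euclidean distance.
  A curve crossing the boundary of the star visits a neighbour \<open>y\<close> of \<open>x\<close>, where the value is the mesh size, and
  the values at both ends differ from it at most by their Euclidean distances to \<open>y\<close>.\<close>

lemma star_cone_Lipschitz:
  assumes x: "x \<in> V q n" and z: "z \<in> gasket q" "z' \<in> gasket q"
  shows "ereal \<bar>star_cone n x z - star_cone n x z'\<bar> \<le> gdist q z z'"
proof (rule gdist_geI)
  fix \<gamma> :: "real \<Rightarrow> real^2"
  assume \<gamma>: "path \<gamma>" "path_image \<gamma> \<subseteq> gasket q" "pathstart \<gamma> = z" "pathfinish \<gamma> = z'"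
  let ?A = "cells_meeting n {x}" and ?B = "cells_missing n {x}"
  have ends: "\<gamma> 0 = z" "\<gamma> 1 = z'" using \<gamma> by (auto simp: pathstart_def pathfinish_def)
  have len: "ereal (dist z z') \<le> curve_length \<gamma>"
    using curve_length_ge_via [of 0 \<gamma>] ends by simp
  show "ereal \<bar>star_cone n x z - star_cone n x z'\<bar> \<le> curve_length \<gamma>"
  proof (cases "z \<in> ?A \<longleftrightarrow> z' \<in> ?A")
    case True
    have "\<bar>dist x z - dist x z'\<bar> \<le> dist z z'"
      by (metis abs_dist_diff_le dist_commute)
    then have "\<bar>star_cone n x z - star_cone n x z'\<bar> \<le> dist z z'"
      using True infdist_triangle_abs [of z _ z'] by (auto simp: star_cone_def)
    then show ?thesis using len by (meson ereal_less_eq(3) order_trans)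
  next
    case False
    have "?A \<inter> ?B \<inter> path_image \<gamma> \<noteq> {}"
    proof
      assume "?A \<inter> ?B \<inter> path_image \<gamma> = {}"
      then have "?A \<inter> path_image \<gamma> = {} \<or> ?B \<inter> path_image \<gamma> = {}"
        using \<gamma> by (intro connected_closedD connected_path_image closed_cells_meeting
            closed_cells_missing) (auto simp: gasket_eq_cells [of n "{x}"])
      moreover have "z \<in> path_image \<gamma>" "z' \<in> path_image \<gamma>" using \<gamma> by auto
      ultimately show False
        using False z gasket_eq_cells [of n "{x}"] by blast
    qed
    then obtain t where t: "0 \<le> t" "t \<le> 1" "\<gamma> t \<in> ?A" "\<gamma> t \<in> ?B"
      by (auto simp: path_image_def)
    have adj: "adj q n x (\<gamma> t)" using star_link x t by blast
    have *: "\<bar>star_cone n x s - mesh n\<bar> \<le> dist s (\<gamma> t)" for s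
    proof (cases "s \<in> ?A")
      case True
      have "\<bar>dist x s - dist x (\<gamma> t)\<bar> \<le> dist s (\<gamma> t)"
        by (metis abs_dist_diff_le dist_commute)
      then show ?thesis using True adj_dist [OF adj] by (simp add: star_cone_def)
    next
      case False
      then show ?thesis
        using adj infdist_le [of "\<gamma> t" "{y. adj q n x y}" s] infdist_nonneg [of s "{y. adj q n x y}"]
        by (simp add: star_cone_def)
    qed
    have "\<bar>star_cone n x z - star_cone n x z'\<bar> \<le> dist z (\<gamma> t) + dist (\<gamma> t) z'"
      using *[of z] *[of z'] by (simp add: dist_commute)
    then show ?thesis
      using curve_length_ge_via [OF t(1,2), of \<gamma>] ends by (meson ereal_less_eq(3) order_trans)
  qed
qed

lemma gLip_star_cone_le:
  assumes x: "x \<in> V q n" and k: "0 \<le> k"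
  shows "gLip q (\<lambda>z. c + k * star_cone n x z) A \<le> ereal k"
  unfolding gLip_def
proof (rule Sup_least, clarify)
  fix z z' assume "z \<in> gtop q closure_of A" "z' \<in> gtop q closure_of A" and ne: "z \<noteq> z'"
  then have g: "z \<in> gasket q" "z' \<in> gasket q"
    by (simp_all add: subsetD [OF closure_of_subset_subtopology])
  have pos: "ereal (dist z z') \<le> gdist q z z'" by (rule dist_le_gdist)
  define D where "D = \<bar>star_cone n x z - star_cone n x z'\<bar>"
  have L: "ereal D \<le> gdist q z z'" unfolding D_def by (rule star_cone_Lipschitz [OF x g])
  have "c + k * star_cone n x z' - (c + k * star_cone n x z) = k * (star_cone n x z' - star_cone n x z)"
    by (simp add: algebra_simps)
  then have d: "\<bar>c + k * star_cone n x z' - (c + k * star_cone n x z)\<bar> = k * D"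
    unfolding D_def abs_minus_commute [of "star_cone n x z"] by (simp only: abs_mult abs_of_nonneg [OF k])
  show "ereal \<bar>c + k * star_cone n x z' - (c + k * star_cone n x z)\<bar> / gdist q z z' \<le> ereal k"
    unfolding d
  proof (cases "gdist q z z'")
    case (real r)
    have "0 < dist z z'" using ne by simp
    also have "dist z z' \<le> r" using pos unfolding real by simp
    finally have "0 < r" .
    moreover have "k * D \<le> k * r"
      using L k unfolding real by (simp add: mult_left_mono)
    ultimately show "ereal (k * D) / gdist q z z' \<le> ereal k" by (simp add: real divide_le_eq)
  next
    case PInf
    then show "ereal (k * D) / gdist q z z' \<le> ereal k" using k by simp
  next
    case MInf
    then show "ereal (k * D) / gdist q z z' \<le> ereal k" using pos by simp
  qed
qed

text \<open>Comparison with a cone with vertex \<open>x\<close>. Let \<open>c\<close> be the cone with \<open>c x = u x\<close> that has the value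
  \<open>M\<close> at height two meshes, so that \<open>c y\<close> is the mean of \<open>u x\<close> and \<open>M\<close>. If \<open>u\<close> exceeded \<open>c\<close> at \<open>y\<close>, consider the component
  \<open>A\<close> containing \<open>y\<close> of the set where \<open>u > c\<close>, within the two rings of cells around \<open>x\<close> and without \<open>x\<close>. On the
  frontier of \<open>A\<close> both functions agree, because \<open>u \<le> M \<le> c\<close> on the outer boundary of the rings. So the
  Lipschitz constant of \<open>u\<close> on \<open>A\<close> is at most the slope of the cone. But the segment from \<open>y\<close> to \<open>x\<close>, along
  which \<open>c\<close> decreases exactly at that slope, leaves \<open>A\<close> at a point where \<open>u = c\<close>, and then
  \<open>u y \<le> c y\<close>.\<close>

lemma AMLE_two_step:
  assumes u: "u \<in> gAMLE q" and x: "x \<in> V q n" "x \<notin> V q 0"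
    and far: "\<And>z. adj q n x z \<Longrightarrow> z \<notin> V q 0"
    and M: "\<And>z p. adj q n x z \<Longrightarrow> p = z \<or> adj q n z p \<Longrightarrow> u p \<le> M"
    and xy: "adj q n x y"
  shows "2 * u y \<le> u x + M"
proof (rule ccontr)
  assume neg: "\<not> 2 * u y \<le> u x + M"
  define k where "k = (M - u x) / (2 * mesh n)"
  have "u x \<le> M" using M [OF xy, of x] adj_sym [OF xy] by blast
  then have k: "0 \<le> k" using mesh_pos [of n] by (simp add: k_def less_imp_le)
  have k2: "k * mesh n = (M - u x) / 2"
    using less_imp_neq [OF mesh_pos [of n]] by (simp add: k_def)
  define c where "c z = u x + k * star_cone n x z" for z
  \<comment> \<open>\<open>Om\<close> is the interior of the two rings; its only vertices of level \<open>n\<close> are \<open>x\<close> and its neighbours.\<close>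
  define K where "K = insert x {y. adj q n x y}"
  define Om where "Om = gasket q - (cells_missing n K \<union> (V q n - K))"
  define W where "W = {z \<in> Om. z \<noteq> x \<and> c z < u z}"
  have contu: "continuous_on (gasket q) u" using u by (simp add: gAMLE_def)
  have cont: "continuous_on (gasket q) (\<lambda>z. u z - c z)"
    unfolding c_def by (intro continuous_intros contu continuous_on_star_cone x)
  have cadj: "star_cone n x z = mesh n" if "adj q n x z" for z
    using that adj_dist [OF that] by (auto simp: star_cone_def)
  have cx: "star_cone n x x = 0"
    using in_some_cell [of x n] V_subset_gasket x by (auto simp: star_cone_def cells_meeting_def)
  have openW: "openin (gtop q) W"
  proof -
    have "closed (cells_missing n K \<union> (V q n - K) \<union> {x})"
      by (intro closed_Un closed_cells_missing finite_imp_closed) (auto simp: finite_V)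
    then have "openin (gtop q) (gasket q \<inter> - (cells_missing n K \<union> (V q n - K) \<union> {x}))"
      by (intro openin_open_Int open_Compl)
    moreover have "openin (gtop q) (gasket q \<inter> (\<lambda>z. u z - c z) -` {0<..})"
      by (intro continuous_openin_preimage_gen cont) simp
    ultimately have "openin (gtop q) ((gasket q \<inter> - (cells_missing n K \<union> (V q n - K) \<union> {x})) \<inter>
        (gasket q \<inter> (\<lambda>z. u z - c z) -` {0<..}))"
      by (rule openin_Int)
    also have "\<dots> = W" by (auto simp: W_def Om_def)
    finally show ?thesis .
  qed
  have yW: "y \<in> W"
    using neg xy cadj [OF xy] k2 adj_neq [OF xy] adj_in_V(2) [OF xy] V_subset_gasket [of q n]
    by (auto simp: W_def Om_def K_def c_def cells_missing_def)
  define A where "A = connected_component_set W y"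
  have openA: "openin (gtop q) A"
    unfolding A_def by (rule locally_connected_2 [OF locally_connected_gasket openW yW])
  have yA: "y \<in> A" using yW by (simp add: A_def connected_component_refl)
  have AW: "A \<subseteq> W" by (simp add: A_def connected_component_subset)
  have xA: "x \<notin> A" using AW by (auto simp: W_def)
  define C where "C = gtop q closure_of A"
  have front: "gtop q frontier_of A = C - A"
    unfolding C_def by (rule frontier_of_openin [OF openA])
  have AC: "A \<subseteq> C" unfolding C_def using closure_of_subset openA openin_subset by metis
  have Cg: "C \<subseteq> gasket q" unfolding C_def by (rule closure_of_subset_subtopology)
  have Cmeet: "C \<subseteq> cells_meeting n K"
    unfolding C_def
  proof (rule closure_of_minimal)
    show "A \<subseteq> cells_meeting n K"
      using AW gasket_eq_cells [of n K] by (auto simp: W_def Om_def)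
    show "closedin (gtop q) (cells_meeting n K)"
      using gasket_eq_cells [of n K] by (intro closed_subset closed_cells_meeting) auto
  qed
  have Cge: "c z \<le> u z" if "z \<in> C" for z
  proof -
    have "C \<subseteq> gasket q \<inter> (\<lambda>z. u z - c z) -` {0..}"
      unfolding C_def
    proof (rule closure_of_minimal)
      show "A \<subseteq> gasket q \<inter> (\<lambda>z. u z - c z) -` {0..}"
        using AW by (auto simp: W_def Om_def)
      show "closedin (gtop q) (gasket q \<inter> (\<lambda>z. u z - c z) -` {0..})"
        by (intro continuous_closedin_preimage cont) simp
    qed
    then show ?thesis using that by auto
  qed
  have notW: "p \<notin> W" if p: "p \<in> C - A" for p
  proof
    assume pW: "p \<in> W"
    have "openin (gtop q) (connected_component_set W p)"
      by (rule locally_connected_2 [OF locally_connected_gasket openW pW])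
    moreover have "p \<in> connected_component_set W p" using pW by (simp add: connected_component_refl)
    moreover have near: "\<exists>a. a \<in> A \<and> a \<in> T" if "openin (gtop q) T" "p \<in> T" for T
      using p that unfolding C_def Diff_iff in_closure_of by blast
    ultimately obtain a where "a \<in> A" "a \<in> connected_component_set W p"
      by (metis near)
    then have "connected_component W y p"
      unfolding A_def by (simp, meson connected_component_sym connected_component_trans)
    then show False using p by (simp add: A_def)
  qed
  have frontle: "u p \<le> c p" if p: "p \<in> C - A" for p
  proof (cases "p \<in> Om")
    case True
    then show ?thesis
      using notW [OF p] by (cases "p = x") (auto simp: W_def c_def cx)
  next
    case False
    obtain w v where w: "length w = n" "p \<in> cell q w" "v \<in> cell q w" "v \<in> K"
      using subsetD [OF Cmeet, of p] p by (auto simp: cells_meeting_def)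
    have vV: "v \<in> V q n" using w(4) x adj_in_V by (auto simp: K_def)
    have pV: "p \<in> V q n" "p \<notin> K"
    proof -
      have "p \<in> V q n \<and> p \<notin> K" if "p \<in> cells_missing n K"
      proof -
        obtain w' where w': "length w' = n" "cell q w' \<inter> K = {}" "p \<in> cell q w'"
          using \<open>p \<in> cells_missing n K\<close> by (auto simp: cells_missing_def)
        then obtain i where "p = psi_word q w (q i)"
          using cell_Int_vertex [of w w' p] w by auto
        then show ?thesis using w w' V_iff by blast
      qed
      then show "p \<in> V q n" "p \<notin> K" using False p Cg by (auto simp: Om_def)
    qed
    have vp: "adj q n v p"
      using V_in_cell_adj [OF vV pV(1) w(3,2,1)] w(4) pV(2) by auto
    then have "v \<noteq> x" using pV by (auto simp: K_def)
    then have "adj q n x v" using w by (auto simp: K_def)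
    then have "u p \<le> M" using M vp by blast
    have "p \<notin> cells_meeting n {x}"
      using V_in_cell_adj [OF x(1) pV(1)] pV(2) by (auto simp: cells_meeting_def K_def)
    moreover have "mesh n \<le> infdist p {y. adj q n x y}"
    proof -
      have "{y. adj q n x y} \<noteq> {}" using xy by blast
      moreover have "mesh n \<le> dist p a" if "a \<in> {y. adj q n x y}" for a
        using that pV by (intro V_separated) (auto simp: K_def dest: adj_in_V)
      ultimately show ?thesis unfolding infdist_notempty [OF \<open>{y. adj q n x y} \<noteq> {}\<close>]
        by (intro cINF_greatest)
    qed
    ultimately have "2 * mesh n \<le> star_cone n x p" by (simp add: star_cone_def)
    then have "k * (2 * mesh n) \<le> k * star_cone n x p" using k by (rule mult_left_mono)
    then have "M \<le> c p" using k2 by (simp add: c_def)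
    with \<open>u p \<le> M\<close> show ?thesis by simp
  qed
  have "gLip q u A \<le> gLip q c A"
  proof -
    have "A \<noteq> gasket q" using xA x V_subset_gasket by blast
    moreover have "connected A" by (simp add: A_def)
    moreover have "A \<subseteq> gasket q - V q 0"
    proof -
      have "V q 0 \<subseteq> V q n - K"
        using x far vertex_in_V by (auto simp: K_def V_0)
      then show ?thesis using AW by (auto simp: W_def Om_def)
    qed
    moreover have "\<forall>p\<in>gtop q frontier_of A. u p = c p"
      unfolding front using frontle Cge by (meson DiffD1 order_antisym)
    ultimately show ?thesis using u openA by (simp add: gAMLE_def)
  qed
  also have "\<dots> \<le> ereal k"
    unfolding c_def by (rule gLip_star_cone_le [OF x(1) k])
  finally have Lipu: "gLip q u A \<le> ereal k" .

  \<comment> \<open>The edge from \<open>x\<close> to \<open>y\<close> is a geodesic in the gasket, and \<open>p\<close> is a point where it meets the frontier of \<open>A\<close>.\<close>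
  obtain w i j where w: "length w = n" "x = psi_word q w (q i)" "y = psi_word q w (q j)"
    using xy by (auto simp: adj_iff)
  have seg: "closed_segment x y \<subseteq> cell q w"
    unfolding w by (rule side_subset_cell)
  have "connectedin (gtop q) (closed_segment x y)"
    using seg cell_subset_gasket by (auto simp: connectedin_subtopology)
  moreover have "closed_segment x y \<inter> A \<noteq> {}" using yA by auto
  moreover have "closed_segment x y - A \<noteq> {}" using xA by auto
  ultimately have "closed_segment x y \<inter> gtop q frontier_of A \<noteq> {}"
    by (rule connectedin_Int_frontier_of)
  then obtain p where p: "p \<in> closed_segment x y" "p \<in> C - A" unfolding front by blast
  have py: "p \<noteq> y" using p yA by auto
  have "p \<in> cells_meeting n {x}"
    using seg p w vertex_in_cell by (auto simp: cells_meeting_def)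
  then have cp: "c p = u x + k * dist x p" by (simp add: c_def star_cone_def)
  have gd: "gdist q p y = ereal (dist p y)"
  proof (rule antisym)
    have "closed_segment p y \<subseteq> closed_segment x y"
      using p by (simp add: subset_closed_segment)
    then show "gdist q p y \<le> ereal (dist p y)"
      using seg cell_subset_gasket by (intro gdist_le_dist) blast
  qed (rule dist_le_gdist)
  have "ereal \<bar>u y - u p\<bar> / gdist q p y \<le> gLip q u A"
    unfolding gLip_def C_def [symmetric]
    by (rule Sup_upper) (use p yA AC py in blast)
  also note Lipu
  finally have "\<bar>u y - u p\<bar> \<le> k * dist p y"
    using py by (simp add: gd divide_le_eq)
  moreover have "dist x p + dist p y = mesh n"
    using p adj_dist [OF xy] by (simp add: between_mem_segment [symmetric] between)
  then have "k * dist x p + k * dist p y = (M - u x) / 2"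
    using k2 by (simp add: distrib_left [symmetric])
  ultimately show False using frontle [OF p(2)] cp neg by argo
qed

end

section \<open>Infinity harmonic functions on the graphs\<close>

text \<open>Comparison for the infinity Laplacian on a finite graph with vertex set \<open>U\<close> and interior \<open>I\<close>, where \<open>a\<close> is
  a subsolution and \<open>b\<close> a supersolution. Suppose that \<open>a - b\<close> has a positive maximum \<open>m\<close>, and among its maximum
  points let \<open>F\<close> collect those where \<open>a\<close> is largest. At \<open>f \<in> F\<close> the two inequalities can hold together only with
  equality for the extremal neighbours, so the neighbour where \<open>a\<close> is largest is again a maximum point of
  \<open>a - b\<close>; the choice of \<open>F\<close> then forces \<open>a\<close> and \<open>b\<close> to be constant on the neighbours of \<open>f\<close>. So \<open>F\<close> is closed
  under adjacency, which is excluded inside \<open>I\<close>.\<close>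

lemma graph_comparison:
  fixes a b :: "'v \<Rightarrow> real"
  assumes fin: "finite U" and IU: "I \<subseteq> U" and NU: "\<And>x y. x \<in> I \<Longrightarrow> N x y \<Longrightarrow> y \<in> U"
    and sub: "\<And>x. x \<in> I \<Longrightarrow> \<exists>y. N x y \<and> (\<forall>z. N x z \<longrightarrow> 2 * a x \<le> a y + a z)"
    and super: "\<And>x. x \<in> I \<Longrightarrow> \<exists>z. N x z \<and> (\<forall>y. N x y \<longrightarrow> b y + b z \<le> 2 * b x)"
    and leave: "\<And>F. F \<subseteq> I \<Longrightarrow> F \<noteq> {} \<Longrightarrow> \<exists>x\<in>F. \<exists>y. N x y \<and> y \<notin> F"
    and bdry: "\<And>x. x \<in> U - I \<Longrightarrow> a x \<le> b x"
    and x: "x \<in> U"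
  shows "a x \<le> b x"
proof (rule ccontr)
  assume "\<not> a x \<le> b x"
  define m where "m = Max ((\<lambda>x. a x - b x) ` U)"
  have le: "a y - b y \<le> m" if "y \<in> U" for y
    using that fin by (simp add: m_def)
  have "0 < m" using le [OF x] \<open>\<not> a x \<le> b x\<close> by simp
  define E where "E = {y \<in> U. a y - b y = m}"
  have "m \<in> (\<lambda>x. a x - b x) ` U"
    unfolding m_def using fin x by (intro Max_in) auto
  then have E: "finite E" "E \<noteq> {}" using fin by (auto simp: E_def)
  have EI: "E \<subseteq> I" using bdry \<open>0 < m\<close> by (fastforce simp: E_def)
  define s where "s = Max (a ` E)"
  have les: "a y \<le> s" if "y \<in> E" for y using that E by (simp add: s_def)
  define F where "F = {y \<in> E. a y = s}"
  have "s \<in> a ` E" unfolding s_def using E by (intro Max_in) auto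
  then have "F \<noteq> {}" by (auto simp: F_def)
  then obtain f e where f: "f \<in> F" "N f e" "e \<notin> F"
    using leave [of F] EI by (auto simp: F_def)
  have fE: "f \<in> E" "f \<in> I" "a f = s" "b f = s - m" using f EI by (auto simp: F_def E_def)
  obtain y where y: "N f y" "\<And>z. N f z \<Longrightarrow> 2 * s \<le> a y + a z"
    using sub [OF fE(2)] fE by auto
  obtain z where z: "N f z" "\<And>y. N f y \<Longrightarrow> b y + b z \<le> 2 * (s - m)"
    using super [OF fE(2)] fE by auto
  have leN: "a v - b v \<le> m" if "N f v" for v using le NU fE that by blast
  note ineqs = leN [OF y(1)] leN [OF z(1)] y(2) [OF z(1)] z(2) [OF y(1)]
  have ay: "a y - b y = m" using ineqs by (intro antisym) auto
  have az: "a z - b z = m" using ineqs by (intro antisym) auto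
  have sum: "a y + a z = 2 * s" using ineqs by (intro antisym) auto
  have "y \<in> E" using ay y NU fE by (auto simp: E_def)
  then have "a y \<le> s" by (rule les)
  moreover have "s \<le> a y"
    using y(2) [OF y(1)] by simp
  ultimately have "a z = s" using sum by simp
  have "s \<le> a e" using y(2) [OF f(2)] \<open>a y \<le> s\<close> by simp
  moreover have "b e \<le> s - m" using z(2) [OF f(2)] az \<open>a z = s\<close> by simp
  ultimately have "a e = s" "a e - b e = m" using leN [OF f(2)] by linarith+
  then have "e \<in> F" using NU fE f by (auto simp: F_def E_def)
  with f show False by simp
qed

context equilateral
begin

text \<open>A point of \<open>F\<close> where \<^term>\<open>bary q 1\<close> is maximal has a neighbour with a larger coordinate.\<close>

lemma V_leave:
  assumes "F \<subseteq> V q n - V q 0" "F \<noteq> {}"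
  shows "\<exists>x\<in>F. \<exists>y. adj q n x y \<and> y \<notin> F"
proof -
  have "finite F" using assms finite_V finite_subset by blast
  then have "Max (bary q 1 ` F) \<in> bary q 1 ` F" using assms by (intro Max_in) auto
  then obtain x where x: "x \<in> F" "bary q 1 x = Max (bary q 1 ` F)" by auto
  have "x \<in> V q n" "x \<noteq> q 1" using x assms by (auto simp: V_0)
  then obtain y where y: "adj q n x y" "bary q 1 y = bary q 1 x + mesh n"
    using adj_towards_vertex by blast
  have "y \<notin> F"
  proof
    assume "y \<in> F"
    then have "bary q 1 y \<le> Max (bary q 1 ` F)" using \<open>finite F\<close> by simp
    then show False using x y mesh_pos [of n] by linarith
  qed
  then show ?thesis using x y by blast
qed

text \<open>The discrete infinity Laplace equation, where the second difference is taken between the neighbours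
  with the largest and the smallest value. Naming these two neighbours makes the equation directly usable as a
  sub- and supersolution inequality.\<close>

definition inf_harmonic :: "nat \<Rightarrow> (real^2 \<Rightarrow> real) \<Rightarrow> bool" where
  "inf_harmonic n f \<longleftrightarrow> (\<forall>x \<in> V q n - V q 0. \<exists>y z. adj q n x y \<and> adj q n x z \<and>
      2 * f x = f y + f z \<and> (\<forall>w. adj q n x w \<longrightarrow> f z \<le> f w \<and> f w \<le> f y))"

lemma inf_harmonic_uminus: "inf_harmonic n f \<Longrightarrow> inf_harmonic n (\<lambda>x. - f x)"
  unfolding inf_harmonic_def
proof (intro ballI)
  fix x assume f: "\<forall>x \<in> V q n - V q 0. \<exists>y z. adj q n x y \<and> adj q n x z \<and>
      2 * f x = f y + f z \<and> (\<forall>w. adj q n x w \<longrightarrow> f z \<le> f w \<and> f w \<le> f y)"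
    and "x \<in> V q n - V q 0"
  then obtain y z where "adj q n x y" "adj q n x z" "2 * f x = f y + f z"
    "\<forall>w. adj q n x w \<longrightarrow> f z \<le> f w \<and> f w \<le> f y" by blast
  then have "adj q n x z \<and> adj q n x y \<and> 2 * - f x = - f z + - f y \<and>
      (\<forall>w. adj q n x w \<longrightarrow> - f y \<le> - f w \<and> - f w \<le> - f z)" by auto
  then show "\<exists>y z. adj q n x y \<and> adj q n x z \<and> 2 * - f x = - f y + - f z \<and>
      (\<forall>w. adj q n x w \<longrightarrow> - f z \<le> - f w \<and> - f w \<le> - f y)"
    by blast
qed

lemma dpath_length_ge:
  assumes "dpath q n K x y N p" "x \<noteq> y"
  shows "1 \<le> N" "x \<in> dbdry q n K \<Longrightarrow> y \<in> dbdry q n K \<Longrightarrow> 2 \<le> N"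
proof -
  show "1 \<le> N" using assms by (cases N) (auto simp: dpath_def)
  moreover assume "x \<in> dbdry q n K" "y \<in> dbdry q n K"
  then have "N \<noteq> 1" using assms by (auto simp: dpath_def)
  ultimately show "2 \<le> N" by simp
qed

lemma dbdry_singleton: "dbdry q n {x} = {y. adj q n x y}"
  using adj_in_V adj_sym adj_neq [of n x x] by (auto simp: dbdry_def)

lemma ddist_singleton_adj:
  assumes "adj q n x y" "a = x \<and> b = y \<or> a = y \<and> b = x"
  shows "ddist q n {x} a b = ereal (mesh n)"
proof -
  have ne: "a \<noteq> b" using assms adj_neq by auto
  have ab: "adj q n a b" using assms adj_sym by auto
  have "dpath q n {x} a b 1 (\<lambda>i. if i = 0 then a else b)"
    using assms ab adj_neq by (auto simp: dpath_def dbdry_singleton)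
  then have "Inf {ereal (real N * mesh n) | N p. dpath q n {x} a b N p} \<le> ereal (real 1 * mesh n)"
    by (intro Inf_lower) blast
  moreover have "ereal (mesh n) \<le> Inf {ereal (real N * mesh n) | N p. dpath q n {x} a b N p}"
  proof (rule Inf_greatest, clarify)
    fix N p assume "dpath q n {x} a b N p"
    then have "1 \<le> N" using dpath_length_ge ne by blast
    then show "ereal (mesh n) \<le> ereal (real N * mesh n)"
      using mult_right_mono [of 1 "real N" "mesh n"] by (simp add: less_imp_le)
  qed
  ultimately show ?thesis using ne by (simp add: ddist_def)
qed

lemma ddist_singleton_bdry:
  assumes "adj q n x y" "adj q n x z" "y \<noteq> z"
  shows "ddist q n {x} y z = ereal (2 * mesh n)"
proof -
  have "dpath q n {x} y z 2 (\<lambda>i. if i = 0 then y else if i = 1 then x else z)"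
    using assms adj_sym by (auto simp: dpath_def less_2_cases_iff)
  then have "Inf {ereal (real N * mesh n) | N p. dpath q n {x} y z N p} \<le> ereal (real 2 * mesh n)"
    by (intro Inf_lower) blast
  moreover have "ereal (2 * mesh n) \<le> Inf {ereal (real N * mesh n) | N p. dpath q n {x} y z N p}"
  proof (rule Inf_greatest, clarify)
    fix N p assume "dpath q n {x} y z N p"
    then have "2 \<le> N" using dpath_length_ge assms dbdry_singleton by blast
    then show "ereal (2 * mesh n) \<le> ereal (real N * mesh n)"
      by (simp add: mult_right_mono less_imp_le)
  qed
  ultimately show ?thesis using assms by (simp add: ddist_def)
qed

text \<open>The minimality property is tested with the one-point set \<open>{x}\<close>, whose boundary points have mutual
  distance two meshes since paths between them have to pass through \<open>x\<close>. The competitor with the midrange value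
  at \<open>x\<close> has the Lipschitz constant enforced by the two extremal boundary values, and the midrange is the only
  value that achieves it.\<close>

lemma dAMLE_harmonic:
  assumes f: "f \<in> dAMLE q n" shows "inf_harmonic n f"
  unfolding inf_harmonic_def
proof
  fix x assume x: "x \<in> V q n - V q 0"
  define N where "N = {y. adj q n x y}"
  have N: "finite N" "N \<noteq> {}"
    using finite_adj adj_towards_vertex [of x n 1] x by (auto simp: N_def V_0)
  have "Max (f ` N) \<in> f ` N" "Min (f ` N) \<in> f ` N"
    using N by (intro Max_in Min_in; auto)+
  then obtain y z where y: "y \<in> N" "f y = Max (f ` N)" and z: "z \<in> N" "f z = Min (f ` N)"
    by auto
  have bounds: "f z \<le> f w \<and> f w \<le> f y" if "w \<in> N" for w
    using that N by (simp add: y z)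
  define v where "v = f(x := (f y + f z) / 2)"
  define L where "L = (f y - f z) / (2 * mesh n)"
  have Lmesh: "L * mesh n = (f y - f z) / 2"
    using less_imp_neq [OF mesh_pos [of n]] by (simp add: L_def)
  have xN: "x \<notin> N" using adj_neq by (auto simp: N_def)
  have cl: "dclosure q n {x} = insert x N"
    by (simp add: dclosure_def dbdry_singleton N_def)
  have d: "ddist q n {x} a b = (if a = b then 0 else if a = x \<or> b = x then ereal (mesh n) else ereal (2 * mesh n))"
    if "a \<in> insert x N" "b \<in> insert x N" for a b
  proof -
    have "ddist q n {x} a a = 0" by (simp add: ddist_def)
    moreover have "ddist q n {x} a b = ereal (mesh n)" if "a = x" "b \<noteq> x"
      using that \<open>b \<in> insert x N\<close> by (intro ddist_singleton_adj [of n x b]) (auto simp: N_def)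
    moreover have "ddist q n {x} a b = ereal (mesh n)" if "a \<noteq> x" "b = x"
      using that \<open>a \<in> insert x N\<close> by (intro ddist_singleton_adj [of n x a]) (auto simp: N_def)
    moreover have "ddist q n {x} a b = ereal (2 * mesh n)" if "a \<noteq> x" "b \<noteq> x" "a \<noteq> b"
      using that \<open>a \<in> insert x N\<close> \<open>b \<in> insert x N\<close>
      by (intro ddist_singleton_bdry) (auto simp: N_def)
    ultimately show ?thesis by auto
  qed
  have "dLip q n f {x} \<le> dLip q n v {x}"
  proof -
    have "dconnected q n {x}" using d by (auto simp: dconnected_def cl)
    moreover have "\<forall>y\<in>dbdry q n {x}. f y = v y"
      using xN by (auto simp: v_def dbdry_singleton N_def)
    moreover have "{x} \<noteq> {}" "{x} \<subseteq> V q n - V q 0" using x by auto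
    moreover have "{x} \<noteq> {} \<and> {x} \<subseteq> V q n - V q 0 \<and> dconnected q n {x} \<and>
        (\<forall>y\<in>dbdry q n {x}. f y = v y) \<longrightarrow> dLip q n f {x} \<le> dLip q n v {x}"
      using f unfolding dAMLE_def mem_Collect_eq by (elim allE)
    ultimately show ?thesis by (elim impE) (intro conjI; assumption)
  qed
  also have "\<dots> \<le> ereal L"
    unfolding dLip_def cl
  proof (rule Sup_least, clarify)
    fix a b assume ab: "a \<in> insert x N" "b \<in> insert x N" "a \<noteq> b"
    define c where "c = (if a = x \<or> b = x then mesh n else 2 * mesh n)"
    have "0 < c" by (simp add: c_def)
    have "\<bar>v a - v b\<bar> \<le> L * c"
    proof (cases "a = x \<or> b = x")
      case True
      have "\<bar>(f y + f z) / 2 - f t\<bar> \<le> (f y - f z) / 2 \<and> \<bar>f t - (f y + f z) / 2\<bar> \<le> (f y - f z) / 2"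
        if "t \<in> N" for t
        unfolding abs_le_iff using bounds [OF that] by (simp add: field_simps)
      then have "\<bar>v a - v b\<bar> \<le> (f y - f z) / 2"
        using ab True by (auto simp: v_def)
      then show ?thesis using True Lmesh by (simp add: c_def)
    next
      case False
      then have "\<bar>v a - v b\<bar> \<le> f y - f z"
        using ab bounds [of a] bounds [of b] by (simp add: v_def abs_le_iff)
      then show ?thesis using False Lmesh by (simp add: c_def)
    qed
    then have "\<bar>v a - v b\<bar> / c \<le> L" using \<open>0 < c\<close> by (simp only: pos_divide_le_eq)
    moreover have "ddist q n {x} a b = ereal c" unfolding d [OF ab(1,2)] using ab(3) by (simp add: c_def)
    ultimately show "ereal \<bar>v a - v b\<bar> / ddist q n {x} a b \<le> ereal L"
      using \<open>0 < c\<close> by simp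
  qed
  finally have L: "dLip q n f {x} \<le> ereal L" .
  have half: "\<bar>f x - f w\<bar> \<le> (f y - f z) / 2" if "w \<in> N" for w
  proof -
    have "ereal \<bar>f x - f w\<bar> / ddist q n {x} x w \<le> dLip q n f {x}"
      unfolding dLip_def cl by (rule Sup_upper) (use that xN in auto)
    also note L
    finally have "ereal \<bar>f x - f w\<bar> / ddist q n {x} x w \<le> ereal L" .
    moreover have "ddist q n {x} x w = ereal (mesh n)"
      using that xN d [of x w] by auto
    ultimately have "\<bar>f x - f w\<bar> / mesh n \<le> L" using mesh_pos [of n] by simp
    then show ?thesis by (simp only: pos_divide_le_eq [OF mesh_pos] Lmesh)
  qed
  have "f y - f x \<le> (f y - f z) / 2" "f x - f z \<le> (f y - f z) / 2"
    using half [OF y(1)] half [OF z(1)] unfolding abs_le_iff by simp_all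
  then have "2 * f x = f y + f z" by (simp add: field_simps)
  then show "\<exists>y z. adj q n x y \<and> adj q n x z \<and> 2 * f x = f y + f z \<and>
      (\<forall>w. adj q n x w \<longrightarrow> f z \<le> f w \<and> f w \<le> f y)"
    using y(1) z(1) bounds unfolding N_def mem_Collect_eq by blast
qed

lemma inf_harmonic_super:
  assumes "inf_harmonic n f" "x \<in> V q n - V q 0"
  shows "\<exists>z. adj q n x z \<and> (\<forall>y. adj q n x y \<longrightarrow> (f y + c) + (f z + c) \<le> 2 * (f x + c))"
proof -
  obtain y z where z: "adj q n x z" and eq: "2 * f x = f y + f z"
    and max: "\<And>w. adj q n x w \<Longrightarrow> f w \<le> f y"
    using assms unfolding inf_harmonic_def by blast
  have "f w + c + (f z + c) \<le> 2 * (f x + c)" if "adj q n x w" for w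
    using max [OF that] eq by (simp add: distrib_left)
  with z show ?thesis by blast
qed

text \<open>At an interior vertex some neighbour has a coordinate larger by one mesh, and no neighbour has one
  smaller by more than that; so the function on the left is a subsolution. It lies below \<open>f\<close> at the corners, and it
  controls \<open>f\<close> near \<^term>\<open>q i\<close>, where the comparison of the next lemma has its boundary.\<close>

lemma inf_harmonic_barrier:
  assumes f: "inf_harmonic n f" and C: "\<And>j. \<bar>f (q i) - f (q j)\<bar> \<le> C" and x: "x \<in> V q n"
  shows "f (q i) - C * (1 - bary q i x) \<le> f x"
proof -
  have C0: "0 \<le> C" using C [of i] by simp
  have "f (q i) - C * (1 - bary q i x) \<le> f x + 0"
  proof (rule graph_comparison [where I = "V q n - V q 0" and N = "adj q n" and U = "V q n"])
    fix x assume x: "x \<in> V q n - V q 0"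
    then obtain y where y: "adj q n x y" "bary q i y = bary q i x + mesh n"
      using adj_towards_vertex [of x n i] by (auto simp: V_0)
    have "2 * (f (q i) - C * (1 - bary q i x)) \<le>
        (f (q i) - C * (1 - bary q i y)) + (f (q i) - C * (1 - bary q i z))" if "adj q n x z" for z
    proof -
      have "2 * bary q i x \<le> bary q i y + bary q i z" using bary_adj [OF that, of i] y by simp
      then have "C * (2 * bary q i x) \<le> C * (bary q i y + bary q i z)"
        using C0 by (rule mult_left_mono)
      then show ?thesis by (simp add: algebra_simps)
    qed
    then show "\<exists>y. adj q n x y \<and> (\<forall>z. adj q n x z \<longrightarrow> 2 * (f (q i) - C * (1 - bary q i x)) \<le>
        (f (q i) - C * (1 - bary q i y)) + (f (q i) - C * (1 - bary q i z)))"
      using y by blast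
    show "\<exists>z. adj q n x z \<and> (\<forall>y. adj q n x y \<longrightarrow> (f y + 0) + (f z + 0) \<le> 2 * (f x + 0))"
      by (rule inf_harmonic_super [OF f x])
  next
    fix x assume "x \<in> V q n - (V q n - V q 0)"
    then obtain j where "x = q j" by (auto simp: V_0)
    then show "f (q i) - C * (1 - bary q i x) \<le> f x + 0"
      using C [of j] by (cases "i = j") (auto simp: bary_vertex)
  qed (use x finite_V V_leave adj_in_V in auto)
  then show ?thesis by simp
qed

text \<open>Let \<open>a x\<close> be the maximum of \<open>u\<close> over \<open>x\<close> and its neighbours, and let \<open>y\<close> be the neighbour of \<open>x\<close> where \<open>a\<close> is
  largest. All vertices at most two edges away from \<open>x\<close> have values at most \<open>a y\<close>, so comparison with the cone at \<open>x\<close> gives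
  \<open>2 * a x \<le> u x + a y\<close>, and \<open>u x \<le> a z\<close> for every neighbour \<open>z\<close>. Hence \<open>a\<close> is a subsolution on the graph as
  long as no corner is within one edge of \<open>x\<close>; at the remaining vertices \<open>a\<close> is at most slightly above the corner value, and \<open>f\<close> at most slightly
  below it.\<close>

lemma AMLE_le_harmonic:
  assumes u: "u \<in> gAMLE q" and f: "inf_harmonic n f" and eq: "\<And>i. f (q i) = u (q i)"
    and C: "\<And>i j. \<bar>u (q i) - u (q j)\<bar> \<le> C"
    and e: "\<And>y z. y \<in> gasket q \<Longrightarrow> z \<in> gasket q \<Longrightarrow> dist y z \<le> 2 * mesh n \<Longrightarrow> \<bar>u y - u z\<bar> \<le> e"
    and x: "x \<in> V q n"
  shows "u x \<le> f x + (e + C * mesh n)"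
proof -
  have C0: "0 \<le> C" using C [of 1 1] by simp
  define N where "N x = {y. adj q n x y}" for x
  define a where "a x = Max (u ` insert x (N x))" for x
  have fin: "finite (insert x (N x))" for x by (simp add: N_def finite_adj)
  have a_ge: "u y \<le> a x" if "y = x \<or> adj q n x y" for x y
    unfolding a_def using fin that by (intro Max_ge) (auto simp: N_def)
  have a_att: "\<exists>y. (y = x \<or> adj q n x y) \<and> a x = u y" for x
  proof -
    have "a x \<in> u ` insert x (N x)" unfolding a_def using fin by (intro Max_in) auto
    then show ?thesis by (auto simp: N_def)
  qed
  define I where "I = {x \<in> V q n. x \<notin> V q 0 \<and> (\<forall>y. adj q n x y \<longrightarrow> y \<notin> V q 0)}"
  have "a x \<le> f x + (e + C * mesh n)"
  proof (rule graph_comparison [where I = I and N = "adj q n" and U = "V q n"])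
    fix x assume x: "x \<in> I"
    have "finite (N x)" "N x \<noteq> {}"
      using fin [of x] adj_towards_vertex [of x n 1] x by (auto simp: N_def I_def V_0)
    then have "Max (a ` N x) \<in> a ` N x" by (intro Max_in) auto
    then obtain y where y: "adj q n x y" "a y = Max (a ` N x)" by (auto simp: N_def)
    have M: "u p \<le> a y" if "adj q n x z" "p = z \<or> adj q n z p" for z p
    proof -
      have "u p \<le> a z" using a_ge that by blast
      also have "a z \<le> a y" unfolding y(2) using \<open>finite (N x)\<close> that by (simp add: N_def)
      finally show ?thesis .
    qed
    have two: "2 * u z \<le> u x + a y" if "adj q n x z" for z
      using x by (intro AMLE_two_step [OF u _ _ _ M that]) (auto simp: I_def)
    have "u x \<le> a y" using a_ge adj_sym [OF y(1)] by blast
    then have ax: "2 * a x \<le> u x + a y" using a_att [of x] two by auto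
    have "2 * a x \<le> a y + a z" if "adj q n x z" for z
      using ax a_ge [of x z] adj_sym [OF that] by auto
    then show "\<exists>y. adj q n x y \<and> (\<forall>z. adj q n x z \<longrightarrow> 2 * a x \<le> a y + a z)"
      using y by blast
    show "\<exists>z. adj q n x z \<and> (\<forall>y. adj q n x y \<longrightarrow>
        f y + (e + C * mesh n) + (f z + (e + C * mesh n)) \<le> 2 * (f x + (e + C * mesh n)))"
      by (rule inf_harmonic_super [OF f]) (use x in \<open>auto simp: I_def\<close>)
  next
    fix x assume x: "x \<in> V q n - I"
    then obtain i where i: "x = q i \<or> adj q n x (q i)" by (auto simp: I_def V_0)
    obtain y where y: "y = x \<or> adj q n x y" "a x = u y" using a_att by blast
    have near: "dist x v \<le> mesh n" if "v = x \<or> adj q n x v" for v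
      using that adj_dist [of n x v] by (auto simp: less_imp_le)
    have "dist x (q i) \<le> mesh n" "dist x y \<le> mesh n"
      by (rule near, use i y in blast)+
    then have "dist y (q i) \<le> 2 * mesh n"
      using dist_triangle [of y "q i" x] by (simp add: dist_commute)
    moreover have "y \<in> gasket q" using y x adj_in_V V_subset_gasket by blast
    ultimately have "a x \<le> u (q i) + e"
      using e [OF _ vertex_in_gasket, of y i] y by (simp add: abs_le_iff)
    moreover have "u (q i) - C * mesh n \<le> f x"
    proof -
      have "1 - bary q i x \<le> mesh n"
        using i bary_adj [OF adj_sym, of n x "q i" i] mesh_pos [of n]
        by (auto simp: bary_vertex less_imp_le)
      then have "C * (1 - bary q i x) \<le> C * mesh n" using C0 by (rule mult_left_mono)
      moreover have "f (q i) - C * (1 - bary q i x) \<le> f x"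
        using x C eq by (intro inf_harmonic_barrier [OF f]) auto
      ultimately show ?thesis by (simp add: eq)
    qed
    ultimately show "a x \<le> f x + (e + C * mesh n)" by simp
  next
    fix F assume "F \<subseteq> I" "F \<noteq> {}"
    then show "\<exists>x\<in>F. \<exists>y. adj q n x y \<and> y \<notin> F"
      by (intro V_leave) (auto simp: I_def)
  qed (use x finite_V adj_in_V in \<open>auto simp: I_def\<close>)
  then show ?thesis using a_ge [of x x] by simp
qed

end

section \<open>Uniform convergence\<close>

theorem theorem4p3:
  fixes q :: "3 \<Rightarrow> real^2"
    and g u :: "real^2 \<Rightarrow> real"
    and un :: "nat \<Rightarrow> real^2 \<Rightarrow> real"
  assumes "unit_triangle q"
    and "\<And>n. un n \<in> dAMLE q n"
    and "\<And>n x. x \<in> V q 0 \<Longrightarrow> un n x = g x"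
    and "u \<in> gAMLE q"
    and "\<And>x. x \<in> V q 0 \<Longrightarrow> u x = g x"
  shows "(\<lambda>n. SUP x\<in>V q n. \<bar>un n x - u x\<bar>) \<longlonglongrightarrow> 0"
proof (rule LIMSEQ_I)
  interpret equilateral q by unfold_locales (rule assms(1))
  fix r :: real assume r: "0 < r"
  have eq: "un n (q i) = u (q i)" for n i
    using assms(3,5) by (simp add: V_0)
  define C where "C = 2 * (\<Sum>i\<in>UNIV. \<bar>u (q i)\<bar>)"
  have C: "\<bar>u (q i) - u (q j)\<bar> \<le> C" for i j
  proof -
    have "\<bar>u (q k)\<bar> \<le> (\<Sum>i\<in>UNIV. \<bar>u (q i)\<bar>)" for k
      by (rule member_le_sum) auto
    from this [of i] this [of j] show ?thesis by (simp add: C_def abs_le_iff)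
  qed
  have "uniformly_continuous_on (gasket q) u"
    using assms(4) by (intro compact_uniformly_continuous compact_gasket) (simp add: gAMLE_def)
  then obtain d where d: "0 < d"
    and ud: "\<And>y z. y \<in> gasket q \<Longrightarrow> z \<in> gasket q \<Longrightarrow> dist z y < d \<Longrightarrow> dist (u z) (u y) < r/4"
    using r unfolding uniformly_continuous_on_def by (metis divide_pos_pos zero_less_numeral)
  have mesh0: "(\<lambda>n. c * mesh n) \<longlonglongrightarrow> 0" for c
    unfolding mesh_def using LIMSEQ_divide_realpow_zero [of 2 c] by simp
  have "\<forall>\<^sub>F n in sequentially. 2 * mesh n < d \<and> C * mesh n < r/4"
    using order_tendstoD(2) [OF mesh0 d] order_tendstoD(2) [OF mesh0, of "r/4" C] r
    by (intro eventually_conj) auto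
  then obtain n0 where n0: "\<And>n. n0 \<le> n \<Longrightarrow> 2 * mesh n < d \<and> C * mesh n < r/4"
    by (auto simp: eventually_sequentially)
  show "\<exists>no. \<forall>n\<ge>no. norm ((SUP x\<in>V q n. \<bar>un n x - u x\<bar>) - 0) < r"
  proof (intro exI [of _ n0] allI impI)
    fix n assume "n0 \<le> n"
    note n = n0 [OF this]
    have e: "\<bar>u y - u z\<bar> \<le> r/4" if "y \<in> gasket q" "z \<in> gasket q" "dist y z \<le> 2 * mesh n" for y z
      using ud [of z y] that n by (simp add: dist_real_def)
    have bound: "\<bar>un n x - u x\<bar> \<le> r/2" if x: "x \<in> V q n" for x
    proof -
      have h: "inf_harmonic n (un n)" by (rule dAMLE_harmonic [OF assms(2)])
      have "u x \<le> un n x + (r/4 + C * mesh n)"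
        by (rule AMLE_le_harmonic [OF assms(4) h eq C e x])
      \<comment> \<open>The reverse inequality is the same statement for the negatives of both functions.\<close>
      moreover have "- u x \<le> - un n x + (r/4 + C * mesh n)"
        by (rule AMLE_le_harmonic [OF gAMLE_uminus [OF assms(4)] inf_harmonic_uminus [OF h] _ _ _ x])
           (use eq C e in \<open>auto simp: abs_minus_commute\<close>)
      ultimately show ?thesis using n by argo
    qed
    have "q 1 \<in> V q n" by (rule vertex_in_V)
    then have "(SUP x\<in>V q n. \<bar>un n x - u x\<bar>) \<le> r/2"
      using bound by (intro cSUP_least) auto
    moreover have "0 \<le> (SUP x\<in>V q n. \<bar>un n x - u x\<bar>)"
      using \<open>q 1 \<in> V q n\<close> finite_V by (intro cSUP_upper2 [of _ _ "q 1"]) auto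
    ultimately show "norm ((SUP x\<in>V q n. \<bar>un n x - u x\<bar>) - 0) < r" using r by simp
  qed
qed

end
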